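(* There exists $t_0>1$ such that for every $t\ge t_0$ the ordinary differential equation $$\frac{d^2h}{dr^2}+\frac2r\frac{dh}{dr}-\frac{6h}{r^2}=-h+h^3+\frac{3h_+}{t}\left(h^3-h^2\right),\qquad r\in(0,\infty),$$ subject to the boundary conditions $$h(0)=0,\qquad h(r)\to1\ \text{ as } r\to\infty,$$ has a unique non-negative solution.
   Context: Here $h_+=\frac{3+\sqrt{9+8t}}{4}$, where $t$ is a real parameter (reduced temperature). *)

theory Defs
  imports Complex_Main
begin

definition h_plus :: "real \<Rightarrow> real" where
  "h_plus t = (3 + sqrt (9 + 8 * t)) / 4"

(* A classical solution on (0,\<infinity>), attaining the boundary value at r = 0 continuously.
   Values of h at negative arguments are irrelevant. *)
definition hedgehog_solution :: "real \<Rightarrow> (real \<Rightarrow> real) \<Rightarrow> bool" where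
  "hedgehog_solution t h \<longleftrightarrow>
     (\<exists>h' h'' :: real \<Rightarrow> real. \<forall>r>0.
        (h has_real_derivative h' r) (at r) \<and>
        (h' has_real_derivative h'' r) (at r) \<and>
        h'' r + 2 / r * h' r - 6 * h r / r\<^sup>2
          = - h r + h r ^ 3 + 3 * h_plus t / t * (h r ^ 3 - h r ^ 2)) \<and>
     continuous_on {0..} h \<and> h 0 = 0 \<and> (h \<longlongrightarrow> 1) at_top"

end

theory Submission
  imports Defs "HOL-Analysis.Analysis" "HOL-Real_Asymp.Real_Asymp"
begin

text \<open>
  With \<open>c = 3 h\<^sub>+ / t\<close>, which tends to \<open>0\<close> as \<open>t\<close> grows, the right-hand side is
  \<open>f h = h (h - 1) (1 + (1 + c) h)\<close>. By the maximum principle \<open>0 \<le> h \<le> 1\<close>, hence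
  \<open>(r^6 (h / r^2)')' = r^4 f h \<le> 0\<close> and \<open>h / r^2\<close> is nonincreasing. Sturm comparison with a sine shows
  that \<open>h\<close> exceeds \<open>1 / 4\<close> on every interval of length \<open>4\<close> in \<open>[7, \<infinity>)\<close>; together, \<open>h \<ge> 1 / 484\<close> on
  \<open>[1, \<infinity>)\<close>, uniformly in \<open>c\<close>.

  Uniqueness: for two solutions \<open>u, v\<close> the Wronskian \<open>W = r^2 (u' v - u v')\<close> satisfies
  \<open>W' = r^2 u v (u - v) ((1 + c) (u + v) - c)\<close>. The last factor is negative only where both solutions are
  smaller than \<open>c\<close>, thus near \<open>0\<close>; there the term \<open>6 / r^2\<close> makes \<open>\<bar>u - v\<bar>\<close> nondecreasing, so this region is
  outweighed by \<open>[1, 2]\<close>. Hence \<open>u / v\<close>, once above \<open>1\<close>, cannot decrease, against \<open>u / v \<rightarrow> 1\<close>.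

  Existence: shooting in \<open>A = lim h / r^2\<close> at \<open>0\<close>. For large \<open>A\<close> the solution exceeds \<open>1\<close>, for small \<open>A\<close> it
  becomes negative; both conditions are open and, with \<open>f\<close> cut off outside \<open>[0, 1]\<close>, they exclude each
  other. An intermediate \<open>A\<close> gives \<open>0 \<le> h \<le> 1\<close>, and the lower bound forces \<open>h \<rightarrow> 1\<close>.
\<close>

section \<open>Bounds for solutions with values in [0, 1]\<close>

definition cubic :: "real \<Rightarrow> real \<Rightarrow> real" where
  "cubic c x = - x + x ^ 3 + c * (x ^ 3 - x ^ 2)"

lemma cubic_factor: "cubic c x = x * (x - 1) * (1 + (1 + c) * x)"
  by (simp add: cubic_def power2_eq_square power3_eq_cube algebra_simps)

lemma cubic_nonpos:
  assumes "0 \<le> c" "0 \<le> x" "x \<le> 1"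
  shows "cubic c x \<le> 0"
proof -
  have "x * (1 - x) * (1 + (1 + c) * x) \<ge> 0"
    using assms by (intro mult_nonneg_nonneg add_nonneg_nonneg) auto
  then show ?thesis by (simp add: cubic_factor algebra_simps)
qed

text \<open>The hypothesis makes k + q / s nondecreasing, so k is at most a constant minus q / s.
  For a function bounded near 0 this excludes a flux of the wrong sign.\<close>

lemma unbounded_below_at_0:
  fixes k k' :: "real \<Rightarrow> real"
  assumes "q > 0" "a > 0"
    and d: "\<And>s. 0 < s \<Longrightarrow> s \<le> a \<Longrightarrow> (k has_real_derivative k' s) (at s)"
    and b: "\<And>s. 0 < s \<Longrightarrow> s \<le> a \<Longrightarrow> q / s\<^sup>2 \<le> k' s"
  shows "\<exists>s. 0 < s \<and> s \<le> a \<and> k s < B"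
proof -
  define M where "M = \<bar>k a\<bar> + q / a + \<bar>B\<bar> + 1"
  have M: "M > 0" using assms by (simp add: M_def add_nonneg_pos)
  define s where "s = min a (q / M)"
  have s: "0 < s" "s \<le> a" using assms M by (auto simp: s_def)
  have "k s + q / s \<le> k a + q / a"
  proof (rule DERIV_nonneg_imp_nondecreasing[OF s(2)])
    fix x assume x: "s \<le> x" "x \<le> a"
    then have "x > 0" using s by simp
    then have "((\<lambda>s. k s + q / s) has_real_derivative k' x - q / x\<^sup>2) (at x)"
      by (auto intro!: derivative_eq_intros d simp: power2_eq_square x)
    moreover have "0 \<le> k' x - q / x\<^sup>2" using b[of x] x \<open>x > 0\<close> by simp
    ultimately show "\<exists>y. ((\<lambda>s. k s + q / s) has_real_derivative y) (at x) \<and> 0 \<le> y" by blast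
  qed
  moreover have "M \<le> q / s"
    using s M assms by (simp add: s_def pos_le_divide_eq min_def field_simps split: if_splits)
  ultimately have "k s < B" unfolding M_def by linarith
  with s show ?thesis by blast
qed

text \<open>A positive interior maximum y would have D1 y = 0 and D2 y > 0; then D1 is positive just
  to the right of y and D exceeds its maximum there.\<close>

lemma no_interior_positive_max:
  fixes D D1 D2 :: "real \<Rightarrow> real"
  assumes cont: "continuous_on {a..b} D"
    and d1: "\<And>y. a < y \<Longrightarrow> y < b \<Longrightarrow> (D has_real_derivative D1 y) (at y)"
    and d2: "\<And>y. a < y \<Longrightarrow> y < b \<Longrightarrow> (D1 has_real_derivative D2 y) (at y)"
    and pos: "\<And>y. a < y \<Longrightarrow> y < b \<Longrightarrow> 0 < D y \<Longrightarrow> D1 y = 0 \<Longrightarrow> 0 < D2 y"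
    and "D a \<le> 0" "D b \<le> 0" "a \<le> x" "x \<le> b"
  shows "D x \<le> 0"
proof (rule ccontr)
  assume "\<not> D x \<le> 0"
  obtain y where y: "y \<in> {a..b}" "\<And>z. z \<in> {a..b} \<Longrightarrow> D z \<le> D y"
    using continuous_attains_sup[OF compact_Icc _ cont] \<open>a \<le> x\<close> \<open>x \<le> b\<close>
    by (metis atLeastAtMost_iff empty_iff)
  have "0 < D y" using y(2)[of x] \<open>\<not> D x \<le> 0\<close> assms by auto
  then have yab: "a < y" "y < b" using y(1) assms by (auto simp: less_le)
  have D1y: "D1 y = 0"
  proof (rule DERIV_local_max[OF d1[OF yab], where d = "min (y - a) (b - y)"])
    show "0 < min (y - a) (b - y)" using yab by simp
    show "\<forall>z. \<bar>y - z\<bar> < min (y - a) (b - y) \<longrightarrow> D z \<le> D y"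
      by (intro allI impI y(2)) (simp add: abs_if split: if_splits)
  qed
  obtain e where e: "e > 0" "\<And>h. 0 < h \<Longrightarrow> h < e \<Longrightarrow> D1 y < D1 (y + h)"
    using DERIV_pos_inc_right[OF d2[OF yab] pos[OF yab \<open>0 < D y\<close> D1y]] by blast
  define z where "z = y + min e (b - y) / 2"
  have z: "y < z" "z < b" "z - y < e" using yab e by (auto simp: z_def min_def field_simps)
  have "D y < D z"
  proof (rule DERIV_pos_imp_increasing_open[OF z(1)])
    fix w assume w: "y < w" "w < z"
    have "D1 y < D1 (y + (w - y))" using e(2)[of "w - y"] w z by simp
    then show "\<exists>l. (D has_real_derivative l) (at w) \<and> 0 < l"
      using d1[of w] D1y w z yab by force
  next
    show "continuous_on {y..z} D"
      by (rule continuous_on_subset[OF cont]) (use yab z in auto)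
  qed
  with y(2)[of z] z yab show False by auto
qed

text \<open>A strong maximum principle without any uniqueness theorem for the singular equation.
  After touching 0 at a, w stays 0, so P vanishes at some later b; being nonincreasing and
  nonpositive, P then vanishes on all of (0,b], and w is constant there.\<close>

lemma zero_of_nonincreasing_flux:
  fixes w P :: "real \<Rightarrow> real"
  assumes d: "\<And>r. 0 < r \<Longrightarrow> (w has_real_derivative P r / r ^ 6) (at r)"
    and mono: "\<And>r s. 0 < r \<Longrightarrow> r \<le> s \<Longrightarrow> P s \<le> P r"
    and neg: "\<And>r. 0 < r \<Longrightarrow> P r \<le> 0"
    and nn: "\<And>r. 0 < r \<Longrightarrow> 0 \<le> w r"
    and "0 < a" "w a = 0" "0 < r"
  shows "w r = 0"
proof -
  have anti: "w s \<le> w x" if "0 < x" "x \<le> s" for x s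
  proof (rule DERIV_nonpos_imp_nonincreasing[OF \<open>x \<le> s\<close>])
    fix y assume "x \<le> y" "y \<le> s"
    then show "\<exists>l. (w has_real_derivative l) (at y) \<and> l \<le> 0"
      using d[of y] neg[of y] that by (intro exI[of _ "P y / y ^ 6"]) (auto intro: divide_nonpos_pos)
  qed
  have z: "w x = 0" if "a \<le> x" for x
  proof -
    have "0 < x" using that \<open>0 < a\<close> by simp
    show ?thesis using anti[OF \<open>0 < a\<close> that] nn[OF \<open>0 < x\<close>] \<open>w a = 0\<close> by linarith
  qed
  define b where "b = r + a"
  have b: "b > 0" "r < b" "a < b" using assms by (auto simp: b_def)
  have "(w has_real_derivative 0) (at b)"
  proof (rule has_field_derivative_transform_within[where f = "\<lambda>_. 0" and d = "b - a"])
    fix x assume "dist x b < b - a"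
    then show "0 = w x" using z[of x] by (auto simp: dist_real_def)
  qed (use b in auto)
  then have "P b / b ^ 6 = 0" using d[OF b(1)] DERIV_unique by blast
  then have Pb: "P b = 0" using b by simp
  have P0: "P x = 0" if "0 < x" "x \<le> b" for x
    using mono[OF that] neg[OF that(1)] Pb by simp
  have "w b = w r"
  proof (rule DERIV_isconst_end[OF b(2)])
    show "continuous_on {r..b} w"
      by (intro DERIV_atLeastAtMost_imp_continuous_on) (meson d \<open>0 < r\<close> less_le_trans)
    show "(w has_real_derivative 0) (at x)" if "r < x" "x < b" for x
      using d[of x] P0[of x] that \<open>0 < r\<close> by auto
  qed
  with z[of b] b show ?thesis by simp
qed

text \<open>The function y = r h satisfies y'' = ((h - 1) (1 + (1 + c) h) + 6 / r^2) y. While h <= 1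
  / 4 and r >= 7, the bracket is at most - 15 / 16 + 6 / 49 < - (4 / 5)^2, so y oscillates faster
  than a sine of frequency 4 / 5 and cannot stay positive over its half period 5 pi / 4.\<close>

lemma sturm_not_small:
  fixes h h' :: "real \<Rightarrow> real"
  assumes c: "0 \<le> c" and R: "7 \<le> R"
    and d1: "\<And>r. R \<le> r \<Longrightarrow> r \<le> R + 5 * pi / 4 \<Longrightarrow> (h has_real_derivative h' r) (at r)"
    and d2: "\<And>r. R \<le> r \<Longrightarrow> r \<le> R + 5 * pi / 4 \<Longrightarrow>
      (h' has_real_derivative (cubic c (h r) + 6 * h r / r\<^sup>2 - 2 / r * h' r)) (at r)"
    and pos: "\<And>r. R \<le> r \<Longrightarrow> r \<le> R + 5 * pi / 4 \<Longrightarrow> 0 < h r"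
  shows "\<exists>r. R \<le> r \<and> r \<le> R + 5 * pi / 4 \<and> 1 / 4 < h r"
proof (rule ccontr)
  assume "\<not> ?thesis"
  then have small: "h r \<le> 1 / 4" if "R \<le> r" "r \<le> R + 5 * pi / 4" for r
    using that by (meson linorder_not_le)
  define S where "S = R + 5 * pi / 4"
  have RS: "R \<le> S" by (simp add: S_def)
  \<comment> \<open>The Wronskian y' z - y z' for z = sin (4 / 5 (r - R)). It is nonincreasing, yet
    the zeros of z at both ends make it negative at R and positive at S.\<close>
  define W where "W = (\<lambda>r. (h r + r * h' r) * sin (4 / 5 * (r - R))
    - r * h r * (4 / 5 * cos (4 / 5 * (r - R))))"
  have "W S \<le> W R"
  proof (rule DERIV_nonpos_imp_nonincreasing[OF RS])
    fix r assume r: "R \<le> r" "r \<le> S"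
    have r0: "r > 0" using r R by simp
    define X where "X = (r * cubic c (h r) + 6 * h r / r + 16 / 25 * (r * h r))
      * sin (4 / 5 * (r - R))"
    have h: "0 < h r" "h r \<le> 1 / 4" using pos[of r] small[of r] r by (auto simp: S_def)
    have "(W has_real_derivative X) (at r)"
      unfolding W_def X_def
      by (rule derivative_eq_intros d1 d2 refl | use r in \<open>simp add: S_def\<close>; fail)+
        (use r0 in \<open>simp add: field_simps power2_eq_square\<close>)
    moreover have "X \<le> 0"
    proof -
      have "4 / 5 * (r - R) \<le> pi" using r by (simp add: S_def)
      then have s: "0 \<le> sin (4 / 5 * (r - R))" using r by (intro sin_ge_zero) auto
      have "c * h r * (1 - h r) \<ge> 0" using c h by simp
      moreover have "h r * h r \<le> 1/4 * (1/4)" using h by (intro mult_mono) auto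
      ultimately have F: "(h r - 1) * (1 + (1 + c) * h r) \<le> - 15 / 16"
        by (simp add: algebra_simps)
      have "49 \<le> r * r" using mult_mono[of 7 r 7 r] r R by simp
      then have "6 / (r * r) \<le> 6 / 49" by (intro divide_left_mono) auto
      with F have "(h r - 1) * (1 + (1 + c) * h r) + 6 / (r * r) + 16 / 25 \<le> 0" by simp
      then have "r * h r * ((h r - 1) * (1 + (1 + c) * h r) + 6 / (r * r) + 16 / 25) \<le> 0"
        using r0 h by (intro mult_nonneg_nonpos) auto
      also have "r * h r * ((h r - 1) * (1 + (1 + c) * h r) + 6 / (r * r) + 16 / 25)
        = r * cubic c (h r) + 6 * h r / r + 16 / 25 * (r * h r)"
        using r0 by (simp add: cubic_factor field_simps)
      finally show ?thesis unfolding X_def using s by (intro mult_nonpos_nonneg) auto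
    qed
    ultimately show "\<exists>y. (W has_real_derivative y) (at r) \<and> y \<le> 0" by blast
  qed
  moreover have "W S = 4 / 5 * (S * h S)" by (simp add: W_def S_def)
  moreover have "W R = - (4 / 5 * (R * h R))" by (simp add: W_def)
  moreover have "0 < S * h S" "0 < R * h R"
    using pos[of S] pos[of R] R RS by (auto simp: S_def intro!: mult_pos_pos add_pos_nonneg)
  ultimately show False by linarith
qed

section \<open>Monotonicity, lower bounds and the limit at infinity of a single profile\<close>

locale hedgehog_profile =
  fixes c :: real and h h' :: "real \<Rightarrow> real"
  assumes c: "0 \<le> c" "c \<le> 1 / 4"
    and deriv: "0 < r \<Longrightarrow> (h has_real_derivative h' r) (at r)"
    and deriv2: "0 < r \<Longrightarrow>
      (h' has_real_derivative (cubic c (h r) + 6 * h r / r\<^sup>2 - 2 / r * h' r)) (at r)"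
    and nonneg: "0 < r \<Longrightarrow> 0 \<le> h r" and le1: "0 < r \<Longrightarrow> h r \<le> 1"
    and lim0: "(h \<longlongrightarrow> 0) (at_right 0)"
    and nontrivial: "\<exists>r>0. h r \<noteq> 0"
begin

text \<open>This is r^6 (h / r^2)'. Since r^2 solves the homogeneous linear equation, the
  differential operator acts on h as r^(-4) times the derivative of this quantity.\<close>

definition flux :: "real \<Rightarrow> real" where
  "flux r = r ^ 4 * h' r - 2 * r ^ 3 * h r"

lemma flux_deriv:
  assumes "0 < r"
  shows "(flux has_real_derivative r ^ 4 * cubic c (h r)) (at r)"
  unfolding flux_def
  by (rule derivative_eq_intros deriv deriv2 refl assms)+
    (use assms in \<open>simp add: field_simps power2_eq_square power3_eq_cube power4_eq_xxxx\<close>)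

lemma ratio_deriv:
  assumes "0 < r"
  shows "((\<lambda>r. h r / r\<^sup>2) has_real_derivative flux r / r ^ 6) (at r)"
  unfolding flux_def
  by (rule derivative_eq_intros deriv refl assms)+
    (use assms in \<open>auto simp: field_simps eval_nat_numeral\<close>)

lemma flux_antimono:
  assumes "0 < r" "r \<le> s"
  shows "flux s \<le> flux r"
proof (rule DERIV_nonpos_imp_nonincreasing[OF assms(2)])
  fix x assume "r \<le> x" "x \<le> s"
  then have "0 < x" using assms by simp
  then have "x ^ 4 * cubic c (h x) \<le> 0"
    using cubic_nonpos[OF c(1) nonneg le1] by (intro mult_nonneg_nonpos) auto
  then show "\<exists>y. (flux has_real_derivative y) (at x) \<and> y \<le> 0"
    using flux_deriv \<open>0 < x\<close> by blast
qed

text \<open>As the flux is nonincreasing, a positive value at r bounds it from below on (0,r], and h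
  / s^2 would tend to minus infinity at 0, against h >= 0.\<close>

lemma flux_nonpos:
  assumes "0 < r"
  shows "flux r \<le> 0"
proof (rule ccontr)
  assume "\<not> flux r \<le> 0"
  then have q: "0 < flux r" by simp
  \<comment> \<open>On (0,1] one has s^6 <= s^2, which reduces the singularity to the order treated
    in \<open>unbounded_below_at_0\<close>.\<close>
  define a where "a = min r 1"
  have "\<exists>s. 0 < s \<and> s \<le> a \<and> h s / s\<^sup>2 < 0"
  proof (rule unbounded_below_at_0[OF q])
    show "0 < a" using assms by (simp add: a_def)
    fix s assume s: "0 < s" "s \<le> a"
    show "((\<lambda>r. h r / r\<^sup>2) has_real_derivative flux s / s ^ 6) (at s)"
      using ratio_deriv s by blast
    have "s ^ 6 \<le> s ^ 2" using s by (intro power_decreasing) (auto simp: a_def)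
    then have "flux r / s\<^sup>2 \<le> flux r / s ^ 6" using q s by (intro divide_left_mono) auto
    also have "\<dots> \<le> flux s / s ^ 6"
      using flux_antimono[of s r] s by (intro divide_right_mono) (auto simp: a_def)
    finally show "flux r / s\<^sup>2 \<le> flux s / s ^ 6" .
  qed
  then show False using nonneg by (metis divide_nonneg_nonneg not_le zero_le_power2)
qed

lemma ratio_antimono:
  assumes "0 < r" "r \<le> s"
  shows "h s / s\<^sup>2 \<le> h r / r\<^sup>2"
proof (rule DERIV_nonpos_imp_nonincreasing[OF assms(2)])
  fix x assume "r \<le> x" "x \<le> s"
  then have "0 < x" using assms by simp
  then show "\<exists>y. ((\<lambda>r. h r / r\<^sup>2) has_real_derivative y) (at x) \<and> y \<le> 0"
    using ratio_deriv flux_nonpos by (meson divide_nonpos_pos zero_less_power)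
qed

lemma positive:
  assumes "0 < r"
  shows "0 < h r"
proof (rule ccontr)
  assume "\<not> 0 < h r"
  then have "h r / r\<^sup>2 = 0" using nonneg[OF assms] by simp
  have "h s / s\<^sup>2 = 0" if "0 < s" for s
    by (rule zero_of_nonincreasing_flux[OF ratio_deriv flux_antimono flux_nonpos _ assms])
      (use nonneg \<open>h r / r\<^sup>2 = 0\<close> that in auto)
  then show False using nontrivial by force
qed

lemma exceeds_quarter:
  assumes "7 \<le> R"
  shows "\<exists>r. R \<le> r \<and> r \<le> R + 4 \<and> 1 / 4 < h r"
proof -
  have "\<exists>r. R \<le> r \<and> r \<le> R + 5 * pi / 4 \<and> 1 / 4 < h r"
    using assms by (intro sturm_not_small[OF c(1) assms, of h h'] deriv deriv2 positive) auto
  moreover have "pi \<le> 16 / 5" using pi_approx by simp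
  ultimately show ?thesis by (force intro: order_trans)
qed

lemma lower_bound_by_later:
  assumes "0 < r" "r \<le> s" "1 / 4 < h s"
  shows "(r / s)\<^sup>2 / 4 \<le> h r"
proof -
  have "(r / s)\<^sup>2 / 4 \<le> (r / s)\<^sup>2 * h s" using mult_left_mono[of "1/4" "h s" "(r / s)\<^sup>2"] assms by simp
  also have "\<dots> \<le> h r"
    using ratio_antimono[OF assms(1,2)] assms by (simp add: field_simps power_divide)
  finally show ?thesis .
qed

text \<open>A point s with h s > 1 / 4 lies in the window of length 4 after max r 7, hence s <= 11 r
  (worst case r = 1). Monotonicity of h / r^2 carries the bound back with the factor (1 / 11)^2, and
  4 * 121 = 484.\<close>

lemma lower_bound:
  assumes "1 \<le> r"
  shows "1 / 484 \<le> h r"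
proof -
  obtain s where s: "r \<le> s" "s \<le> 11 * r" "1 / 4 < h s"
  proof -
    obtain s where "max r 7 \<le> s" "s \<le> max r 7 + 4" "1 / 4 < h s"
      using exceeds_quarter[of "max r 7"] by auto
    moreover have "max r 7 + 4 \<le> 11 * r" using assms by simp
    ultimately show thesis by (intro that[of s]) auto
  qed
  have "1 / 11 \<le> r / s" using s assms by (simp add: field_simps)
  then have "(1 / 11)\<^sup>2 \<le> (r / s)\<^sup>2" by (intro power_mono) auto
  moreover have "(1 / 11 :: real)\<^sup>2 = 1 / 121" by (simp add: power2_eq_square)
  ultimately have "1 / 484 \<le> (r / s)\<^sup>2 / 4" by linarith
  also have "\<dots> \<le> h r" using lower_bound_by_later[of r s] s assms by simp
  finally show ?thesis .
qed

text \<open>On (0,2], (r^2 h')' = h (6 - r^2 (1 - h) (1 + (1 + c) h)) >= 0, because r^2 <= 4 and the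
  product is at most 5 / 4. A negative value of r^2 h' would therefore persist towards 0 and make h
  unbounded there.\<close>

lemma deriv_nonneg:
  assumes "0 < r" "r \<le> 2"
  shows "0 \<le> h' r"
proof (rule ccontr)
  assume "\<not> 0 \<le> h' r"
  then have q: "0 < - (r\<^sup>2 * h' r)" using assms by (simp add: mult_pos_neg)
  have mono: "s\<^sup>2 * h' s \<le> r\<^sup>2 * h' r" if s: "0 < s" "s \<le> r" for s
  proof (rule DERIV_nonneg_imp_nondecreasing[OF s(2)])
    fix x assume x: "s \<le> x" "x \<le> r"
    then have x0: "0 < x" "x \<le> 2" using s assms by auto
    have "((\<lambda>s. s\<^sup>2 * h' s) has_real_derivative 6 * h x + x\<^sup>2 * cubic c (h x)) (at x)"
      by (rule derivative_eq_intros deriv deriv2 refl x0)+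
        (use x0 in \<open>simp add: field_simps power2_eq_square\<close>)
    moreover have "0 \<le> 6 * h x + x\<^sup>2 * cubic c (h x)"
    proof -
      have "x * x \<le> 2 * 2" using x0 by (intro mult_mono) auto
      moreover have "(1 - h x) * (1 + (1 + c) * h x) \<le> 5 / 4"
      proof -
        have "c * h x * (1 - h x) \<le> 1/4 * 1 * 1"
          using c nonneg[OF x0(1)] le1[OF x0(1)] by (intro mult_mono) auto
        moreover have "0 \<le> h x * h x" by simp
        moreover have "(1 - h x) * (1 + (1 + c) * h x) = 1 + c * h x * (1 - h x) - h x * h x"
          by (simp add: algebra_simps)
        ultimately show ?thesis by linarith
      qed
      moreover have "0 \<le> (1 - h x) * (1 + (1 + c) * h x)"
        using c nonneg[OF x0(1)] le1[OF x0(1)] by simp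
      ultimately have "(x * x) * ((1 - h x) * (1 + (1 + c) * h x)) \<le> 4 * (5 / 4)"
        by (intro mult_mono) auto
      then have "0 \<le> h x * (6 - (x * x) * ((1 - h x) * (1 + (1 + c) * h x)))"
        using nonneg[OF x0(1)] by simp
      then show ?thesis by (simp add: cubic_factor power2_eq_square algebra_simps)
    qed
    ultimately show "\<exists>y. ((\<lambda>s. s\<^sup>2 * h' s) has_real_derivative y) (at x) \<and> 0 \<le> y" by blast
  qed
  have "\<exists>s. 0 < s \<and> s \<le> r \<and> - h s < - 1"
  proof (rule unbounded_below_at_0[OF q assms(1)])
    fix s assume s: "0 < s" "s \<le> r"
    show "((\<lambda>s. - h s) has_real_derivative - h' s) (at s)"
      using deriv[OF s(1)] by (rule DERIV_minus)
    show "- (r\<^sup>2 * h' r) / s\<^sup>2 \<le> - h' s"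
      using mono[OF s] s by (simp add: field_simps)
  qed
  then show False using le1 by force
qed

lemma scaled_deriv_le:
  assumes "0 < r"
  shows "r * h' r \<le> 2 * h r"
proof -
  have "r ^ 3 * (r * h' r - 2 * h r) \<le> 0"
    using flux_nonpos[OF assms] by (simp add: flux_def algebra_simps eval_nat_numeral)
  then show ?thesis using assms by (simp add: mult_le_0_iff)
qed

lemma mono_near_0:
  assumes "0 < r" "r \<le> s" "s \<le> 2"
  shows "h r \<le> h s"
proof (rule DERIV_nonneg_imp_nondecreasing[OF assms(2)])
  fix x assume "r \<le> x" "x \<le> s"
  then show "\<exists>y. (h has_real_derivative y) (at x) \<and> 0 \<le> y"
    using assms deriv[of x] deriv_nonneg[of x] by auto
qed

text \<open>By \<open>lower_bound\<close>, y = r (1 - h) satisfies y'' >= y / 484 - 6 / r. The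
  right-hand side of the claim is a barrier: 5808 = 12 * 484 yields 12 / r, half of it for the term
  6 / r and half for the second derivative of 5808 / r, as 44^2 = 1936; the exponential fits because
  22^2 = 484.\<close>

lemma deviation_bound:
  assumes "44 \<le> r" "0 < e"
  shows "r * (1 - h r) \<le> 5808 / r + e * exp (r / 22)"
proof -
  define D where "D = (\<lambda>r. r * (1 - h r) - 5808 / r - e * exp (r / 22))"
  define D1 where "D1 = (\<lambda>r. 1 - h r - r * h' r + 5808 / r\<^sup>2 - e / 22 * exp (r / 22))"
  define D2 where "D2 = (\<lambda>r. - (r * cubic c (h r)) - 6 * h r / r - 2 * 5808 / r ^ 3
      - e / 484 * exp (r / 22))"
  \<comment> \<open>The exponential outgrows r, an upper bound for r (1 - h), so the comparison can
    be made on a bounded interval.\<close>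
  have "filterlim (\<lambda>x::real. e * exp (x / 22) - x) at_top at_top"
    using assms(2) by real_asymp
  then have "\<forall>\<^sub>F x in at_top. 0 < e * exp (x / 22) - x"
    by (rule filterlim_at_top_dense[THEN iffD1, rule_format])
  then obtain X where X: "r \<le> X" "X < e * exp (X / 22)"
    by (metis (mono_tags, lifting) diff_gt_0_iff_gt eventually_at_top_linorder linorder_le_cases order_refl)
  have "D r \<le> 0"
  proof (rule no_interior_positive_max[where a = 44 and b = X and D = D and ?D1.0 = D1 and ?D2.0 = D2])
    have d1: "(D has_real_derivative D1 y) (at y)" if "44 \<le> y" for y
      unfolding D_def D1_def using that
      by (auto intro!: derivative_eq_intros deriv simp: field_simps power2_eq_square)
    then show "(D has_real_derivative D1 y) (at y)" if "44 < y" "y < X" for y using that by simp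
    show "continuous_on {44..X} D"
      using d1 by (intro DERIV_atLeastAtMost_imp_continuous_on) auto
    show "(D1 has_real_derivative D2 y) (at y)" if "44 < y" "y < X" for y
      unfolding D1_def D2_def
      by (rule derivative_eq_intros deriv deriv2 refl | use that in simp; fail)+
        (use that in \<open>simp add: field_simps eval_nat_numeral\<close>)
    show "0 < D2 y" if y: "44 < y" "y < X" "0 < D y" "D1 y = 0" for y
    proof -
      have h: "1 / 484 \<le> h y" "h y \<le> 1" using lower_bound[of y] le1[of y] y by auto
      have "(1 / 484) * 1 \<le> h y * (1 + (1 + c) * h y)" using h c by (intro mult_mono) auto
      then have "(1 / 484) * (y * (1 - h y)) \<le> h y * (1 + (1 + c) * h y) * (y * (1 - h y))"
        using h y by (intro mult_right_mono) auto
      also have "\<dots> = - (y * cubic c (h y))" by (simp add: cubic_factor algebra_simps)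
      finally have 1: "y * (1 - h y) / 484 \<le> - (y * cubic c (h y))" by simp
      have 2: "6 * h y / y \<le> 6 / y" using h y by (intro divide_right_mono) auto
      have "2 * 5808 / y ^ 3 \<le> 6 / y"
      proof -
        have "1936 \<le> y * y" using mult_mono[of 44 y 44 y] y by simp
        then show ?thesis using y by (simp add: field_simps eval_nat_numeral)
      qed
      moreover have "12 / y + e / 484 * exp (y / 22) < y * (1 - h y) / 484"
        using y(3) by (simp add: D_def)
      ultimately show ?thesis using 1 2 unfolding D2_def by simp
    qed
    show "D 44 \<le> 0"
    proof -
      have "0 \<le> e * exp (44 / 22)" using assms by simp
      then show ?thesis using nonneg[of 44] by (simp add: D_def)
    qed
    show "D X \<le> 0"
    proof -
      have "0 \<le> X * h X" "0 \<le> 5808 / X" using nonneg[of X] X assms by auto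
      then show ?thesis using X unfolding D_def right_diff_distrib by linarith
    qed
  qed (use X assms in auto)
  then show ?thesis by (simp add: D_def)
qed

text \<open>Letting e tend to 0 in \<open>deviation_bound\<close> gives 1 - h <= 5808 / r^2. The
  condition at infinity is thus a consequence of the bounds in \<open>hedgehog_profile\<close>, and
  shooting only has to provide these.\<close>

lemma tendsto_1: "(h \<longlongrightarrow> 1) at_top"
proof (rule tendsto_sandwich)
  have b: "1 - 5808 / r\<^sup>2 \<le> h r" if "44 \<le> r" for r
  proof -
    have "r * (1 - h r) \<le> 5808 / r"
    proof (rule field_le_epsilon)
      fix e :: real assume "0 < e"
      then show "r * (1 - h r) \<le> 5808 / r + e"
        using deviation_bound[OF that, of "e / exp (r / 22)"] by simp
    qed
    then show ?thesis using that by (simp add: field_simps power2_eq_square)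
  qed
  then show "\<forall>\<^sub>F r in at_top. 1 - 5808 / r\<^sup>2 \<le> h r"
    unfolding eventually_at_top_linorder by blast
  show "\<forall>\<^sub>F r in at_top. h r \<le> 1"
    using eventually_gt_at_top[of 0] by eventually_elim (rule le1)
  show "((\<lambda>r::real. 1 - 5808 / r\<^sup>2) \<longlongrightarrow> 1) at_top" by real_asymp
qed simp

end

section \<open>Uniqueness\<close>

lemma first_zero:
  fixes d :: "real \<Rightarrow> real"
  assumes cont: "continuous_on {x..y} d" and "x \<le> y" "0 < d x" "d y \<le> 0"
  shows "\<exists>b. x < b \<and> b \<le> y \<and> d b = 0 \<and> (\<forall>z. x \<le> z \<and> z < b \<longrightarrow> 0 < d z)"
proof -
  define S where "S = {z \<in> {x..y}. d z \<le> 0}"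
  have "compact S" unfolding S_def
    using continuous_closed_preimage[OF cont closed_atLeastAtMost, of "{..0}"]
    by (intro compact_eq_bounded_closed[THEN iffD2] conjI bounded_subset[OF bounded_closed_interval[of x y]])
      (auto simp: vimage_def Int_def)
  moreover have "S \<noteq> {}" using assms by (auto simp: S_def)
  ultimately obtain b where b: "b \<in> S" "\<And>z. z \<in> S \<Longrightarrow> b \<le> z"
    by (metis compact_attains_inf)
  have pos: "0 < d z" if "x \<le> z" "z < b" for z
    using b(2)[of z] that b(1) by (force simp: S_def)
  have xb: "x < b" using b(1) assms by (auto simp: S_def less_le)
  obtain w where w: "x \<le> w" "w \<le> b" "d w = 0"
    using IVT2'[of d b 0 x] b(1) xb assms continuous_on_subset[OF cont, of "{x..b}"]
    by (auto simp: S_def)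
  then have "w = b" using pos[of w] by (cases "w < b") auto
  with w xb pos b(1) show ?thesis by (auto simp: S_def)
qed

lemma last_zero:
  fixes d :: "real \<Rightarrow> real"
  assumes cont: "continuous_on {x..y} d" and "x \<le> y" "0 < d y" "d x \<le> 0"
  shows "\<exists>a. x \<le> a \<and> a < y \<and> d a = 0 \<and> (\<forall>z. a < z \<and> z \<le> y \<longrightarrow> 0 < d z)"
proof -
  have "continuous_on {-y..-x} (\<lambda>z. d (- z))"
    by (rule continuous_on_compose2[OF cont]) (auto intro: continuous_intros)
  then obtain b where b: "- y < b" "b \<le> - x" "d (- b) = 0"
    "\<And>z. - y \<le> z \<Longrightarrow> z < b \<Longrightarrow> 0 < d (- z)"
    using first_zero[of "- y" "- x" "\<lambda>z. d (- z)"] assms by auto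
  have "0 < d z" if "- b < z" "z \<le> y" for z
    using b(4)[of "- z"] that by simp
  with b show ?thesis by (intro exI[of _ "- b"]) auto
qed

section \<open>The difference and the Wronskian of two profiles\<close>

locale two_profiles =
  u: hedgehog_profile c u u' + v: hedgehog_profile c v v'
  for c :: real and u u' v v' :: "real \<Rightarrow> real" +
  assumes c_small: "c \<le> 1 / 500"
begin

lemma swap: "two_profiles c v v' u u'"
  by (intro two_profiles.intro two_profiles_axioms.intro u.hedgehog_profile_axioms
      v.hedgehog_profile_axioms c_small)

definition d :: "real \<Rightarrow> real" where "d r = u r - v r"
definition d' :: "real \<Rightarrow> real" where "d' r = u' r - v' r"
definition W :: "real \<Rightarrow> real" where "W r = r\<^sup>2 * (u' r * v r - u r * v' r)"

lemma d_deriv: "0 < r \<Longrightarrow> (d has_real_derivative d' r) (at r)"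
  unfolding d_def d'_def by (intro DERIV_diff u.deriv v.deriv)

lemma d_cont: "0 < x \<Longrightarrow> continuous_on {x..y} d"
  using d_deriv by (intro DERIV_atLeastAtMost_imp_continuous_on) (meson less_le_trans)

text \<open>The derivative is r^2 d'^2 + (6 + r^2 V) d^2, where V is the difference quotient of
  \<open>cubic\<close> between u and v. As V >= - 3 / 2, the bracket is nonnegative exactly as far
  as r^2 <= 4 guarantees it; hence the end point 2.\<close>

lemma energy_mono:
  assumes "0 < r" "r \<le> s" "s \<le> 2"
  shows "r\<^sup>2 * d r * d' r \<le> s\<^sup>2 * d s * d' s"
proof (rule DERIV_nonneg_imp_nondecreasing[OF assms(2)])
  fix x assume "r \<le> x" "x \<le> s"
  then have x: "0 < x" "x \<le> 2" using assms by auto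
  have der: "((\<lambda>r. r\<^sup>2 * d r * d' r) has_real_derivative
      x\<^sup>2 * (d' x)\<^sup>2 + 6 * (d x)\<^sup>2 + x\<^sup>2 * d x * (cubic c (u x) - cubic c (v x))) (at x)"
    unfolding d_def d'_def
    by (rule derivative_eq_intros u.deriv v.deriv u.deriv2 v.deriv2 refl x)+
      (use x in \<open>simp add: field_simps power2_eq_square\<close>)
  define V where "V = (1 + c) * ((u x)\<^sup>2 + u x * v x + (v x)\<^sup>2) - c * (u x + v x) - 1"
  have eq: "cubic c (u x) - cubic c (v x) = d x * V"
    by (simp add: cubic_def d_def V_def algebra_simps power2_eq_square power3_eq_cube)
  have uv: "0 \<le> u x" "u x \<le> 1" "0 \<le> v x" "v x \<le> 1"
    using u.nonneg u.le1 v.nonneg v.le1 x by auto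
  have "c * (u x + v x) \<le> 1 / 4 * 2" using u.c uv by (intro mult_mono) auto
  moreover have "0 \<le> (1 + c) * ((u x)\<^sup>2 + u x * v x + (v x)\<^sup>2)" using u.c uv by simp
  ultimately have "- (3 / 2) \<le> V" unfolding V_def by linarith
  moreover have "x * x \<le> 2 * 2" using x by (intro mult_mono) auto
  moreover have "(x * x) * (- V) \<le> (x * x) * (3 / 2)"
    using \<open>- (3 / 2) \<le> V\<close> by (intro mult_left_mono) auto
  ultimately have "(x * x) * (- V) \<le> 6" by linarith
  then have "0 \<le> (d x)\<^sup>2 * (6 - (x * x) * (- V))" by (intro mult_nonneg_nonneg) auto
  moreover have "0 \<le> x\<^sup>2 * (d' x)\<^sup>2" by simp
  ultimately have "0 \<le> x\<^sup>2 * (d' x)\<^sup>2 + 6 * (d x)\<^sup>2 + x\<^sup>2 * d x * (cubic c (u x) - cubic c (v x))"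
    unfolding eq by (simp add: power2_eq_square algebra_simps)
  with der show "\<exists>y. ((\<lambda>r. r\<^sup>2 * d r * d' r) has_real_derivative y) (at x) \<and> 0 \<le> y" by blast
qed

lemma scaled_derivs:
  assumes "0 < r" "r \<le> 2"
  shows "0 \<le> r * u' r" "r * u' r \<le> 2" "0 \<le> r * v' r" "r * v' r \<le> 2"
  using u.deriv_nonneg[OF assms] v.deriv_nonneg[OF assms] u.scaled_deriv_le[OF assms(1)]
    v.scaled_deriv_le[OF assms(1)] u.le1[OF assms(1)] v.le1[OF assms(1)] assms by auto

text \<open>The quantity is nondecreasing and, by the bounds on r u' and r v', of order r near 0, so
  it starts from the limit 0.\<close>

lemma energy_nonneg:
  assumes "0 < r" "r \<le> 2"
  shows "0 \<le> r\<^sup>2 * d r * d' r"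
proof (rule ccontr)
  define q where "q = - (r\<^sup>2 * d r * d' r)"
  assume "\<not> ?thesis"
  then have q: "0 < q" by (simp add: q_def)
  \<comment> \<open>At s the quantity is at most 2 s <= q / 2 in absolute value, while monotonicity
    forces it below - q.\<close>
  define s where "s = min r (q / 4)"
  have s: "0 < s" "s \<le> r" "s \<le> q / 4" using assms q by (auto simp: s_def)
  have "\<bar>d s\<bar> \<le> 1" using u.nonneg[of s] u.le1[of s] v.nonneg[of s] v.le1[of s] s by (simp add: d_def)
  moreover have "\<bar>s * d' s\<bar> \<le> 2"
    using scaled_derivs[of s] s assms by (simp add: d'_def right_diff_distrib)
  ultimately have "s * (\<bar>d s\<bar> * \<bar>s * d' s\<bar>) \<le> q / 4 * (1 * 2)"
    using s by (intro mult_mono) auto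
  then have "\<bar>s\<^sup>2 * d s * d' s\<bar> \<le> q / 2"
    using s by (simp add: abs_mult power2_eq_square mult_ac)
  moreover have "s\<^sup>2 * d s * d' s \<le> - q"
    using energy_mono[of s r] s assms by (simp add: q_def)
  ultimately show False using q by linarith
qed

lemma abs_d_mono:
  assumes "0 < r" "r \<le> s" "s \<le> 2"
  shows "\<bar>d r\<bar> \<le> \<bar>d s\<bar>"
proof -
  have "(d r)\<^sup>2 \<le> (d s)\<^sup>2"
  proof (rule DERIV_nonneg_imp_nondecreasing[OF assms(2)])
    fix x assume "r \<le> x" "x \<le> s"
    then have x: "0 < x" "x \<le> 2" using assms by auto
    have "((\<lambda>r. (d r)\<^sup>2) has_real_derivative 2 * (d x * d' x)) (at x)"
      by (rule derivative_eq_intros d_deriv refl x)+ simp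
    moreover have "0 \<le> x\<^sup>2 * (d x * d' x)" using energy_nonneg[OF x] by (simp add: mult_ac)
    then have "0 \<le> 2 * (d x * d' x)" using x by (simp add: zero_le_mult_iff)
    ultimately show "\<exists>y. ((\<lambda>r. (d r)\<^sup>2) has_real_derivative y) (at x) \<and> 0 \<le> y" by blast
  qed
  then show ?thesis by (simp add: abs_le_square_iff)
qed

text \<open>As \<bar>d\<bar> is nondecreasing on (0,2], a zero of d would force d to vanish at all
  earlier points.\<close>

lemma d_pos_forward:
  assumes "0 < r" "r \<le> s" "s \<le> 2" "0 < d r"
  shows "0 < d s"
proof (rule ccontr)
  assume "\<not> 0 < d s"
  then obtain b where "r < b" "b \<le> s" "d b = 0"
    using first_zero[OF d_cont, of r s] assms by auto
  then show False using abs_d_mono[of r b] assms by simp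
qed

lemma d_nonneg_backward:
  assumes "0 < r" "r \<le> s" "s \<le> 2" "0 < d s"
  shows "0 \<le> d r"
proof (rule ccontr)
  interpret sw: two_profiles c v v' u u' by (rule swap)
  assume "\<not> 0 \<le> d r"
  then have "0 < sw.d r" by (simp add: sw.d_def d_def)
  from sw.d_pos_forward[OF assms(1-3) this] assms(4) show False
    by (simp add: sw.d_def d_def)
qed

text \<open>The linear terms, including 6 / r^2, cancel in u'' v - u v''. What remains is u v times
  the difference of (1 + c) x^2 - c x - 1 at x = u and x = v, which contains the factor u -
  v.\<close>

lemma W_deriv:
  assumes "0 < r"
  shows "(W has_real_derivative
    (r\<^sup>2 * u r * v r * d r) * ((1 + c) * (u r + v r) - c)) (at r)"
  unfolding W_def d_def
  by (rule derivative_eq_intros u.deriv v.deriv u.deriv2 v.deriv2 refl assms)+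
    (use assms in \<open>simp add: field_simps cubic_def power2_eq_square power3_eq_cube\<close>)

lemma W_cont: "0 < x \<Longrightarrow> continuous_on {x..y} W"
  using W_deriv by (intro DERIV_atLeastAtMost_imp_continuous_on) (meson less_le_trans)

text \<open>This replaces an initial value of W at 0; only a lower bound is needed to show W >= 0
  later.\<close>

lemma W_small:
  assumes "0 < s" "s \<le> 2"
  shows "- (2 * s) \<le> W s"
proof -
  have "0 \<le> s * u' s * v s" using scaled_derivs[OF assms] v.nonneg[OF assms(1)] by simp
  moreover have "u s * (s * v' s) \<le> 1 * 2"
    using scaled_derivs[OF assms] u.nonneg[OF assms(1)] u.le1[OF assms(1)] by (intro mult_mono) auto
  ultimately have "- 2 \<le> s * u' s * v s - u s * (s * v' s)" by linarith
  then have "s * (- 2) \<le> s * (s * u' s * v s - u s * (s * v' s))"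
    using assms by (intro mult_left_mono) auto
  then show ?thesis by (simp add: W_def power2_eq_square algebra_simps)
qed

text \<open>The bound 1 / 500 on c lies below 1 / 484 from \<open>lower_bound\<close>, so u + v is
  at least 2 c on [1, \<infinity>).\<close>

lemma coefficient_ge:
  assumes "1 \<le> r"
  shows "c \<le> (1 + c) * (u r + v r) - c"
proof -
  have "1 * (1 / 484 + 1 / 484) \<le> (1 + c) * (u r + v r)"
    using u.lower_bound[OF assms] v.lower_bound[OF assms] u.c by (intro mult_mono) auto
  then show ?thesis using c_small by simp
qed

text \<open>The integrand of \<open>W\<close> is a nondecreasing weight times a factor that is at least \<open>- c\<close> on
  \<open>(0,1]\<close> and at least \<open>c\<close> on \<open>[1,2]\<close>, so the first contribution is compensated by the second.\<close>

lemma W_2_nonneg: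
  assumes "0 < d 2"
  shows "0 \<le> W 2"
proof -
  define p where "p = (\<lambda>r. r\<^sup>2 * u r * v r * d r)"
  have d0: "0 \<le> d r" if "0 < r" "r \<le> 2" for r
    using d_nonneg_backward[of r 2] that assms by simp
  have p_mono: "p r \<le> p s" if "0 < r" "r \<le> s" "s \<le> 2" for r s
    unfolding p_def using that d0[of r] d0[of s] abs_d_mono[of r s]
      u.mono_near_0[of r s] v.mono_near_0[of r s] u.nonneg[of r] v.nonneg[of r] u.nonneg[of s] v.nonneg[of s]
    by (intro mult_mono power_mono) auto
  have p0: "0 \<le> p r" if "0 < r" "r \<le> 2" for r
    unfolding p_def using that d0 u.nonneg v.nonneg by simp
  have W1: "- (c * p 1) \<le> W 1"
  proof (rule field_le_epsilon)
    fix e :: real assume e: "0 < e"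
    define s where "s = min 1 (e / 2)"
    have s: "0 < s" "s \<le> 1" "2 * s \<le> e" using e by (auto simp: s_def)
    have "W s + c * p 1 * s \<le> W 1 + c * p 1 * 1"
    proof (rule DERIV_nonneg_imp_nondecreasing[OF s(2), of "\<lambda>x. W x + c * p 1 * x"])
      fix x assume "s \<le> x" "x \<le> 1"
      then have x: "0 < x" "x \<le> 1" using s by auto
      have "((\<lambda>x. W x + c * p 1 * x) has_real_derivative
          p x * ((1 + c) * (u x + v x) - c) + c * p 1) (at x)"
        unfolding p_def by (rule derivative_eq_intros W_deriv refl x)+ simp
      moreover have "- (c * p 1) \<le> p x * ((1 + c) * (u x + v x) - c)"
      proof -
        have "c * p x \<le> c * p 1" using p_mono[of x 1] x u.c by (intro mult_left_mono) auto
        moreover have "0 \<le> p x * ((1 + c) * (u x + v x))"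
          using p0[of x] x u.c u.nonneg[of x] v.nonneg[of x] by simp
        ultimately show ?thesis by (simp add: algebra_simps)
      qed
      ultimately show "\<exists>y. ((\<lambda>x. W x + c * p 1 * x) has_real_derivative y) (at x) \<and> 0 \<le> y"
        by (intro exI conjI) auto
    qed
    moreover have "0 \<le> c * p 1 * s" using p0[of 1] u.c s by simp
    ultimately show "- (c * p 1) \<le> W 1 + e" using W_small[of s] s by simp
  qed
  have "W 1 - c * p 1 * 1 \<le> W 2 - c * p 1 * 2"
  proof (rule DERIV_nonneg_imp_nondecreasing[of 1 2 "\<lambda>x. W x - c * p 1 * x"])
    fix x :: real assume x: "1 \<le> x" "x \<le> 2"
    then have x0: "0 < x" by simp
    have "((\<lambda>x. W x - c * p 1 * x) has_real_derivative
        p x * ((1 + c) * (u x + v x) - c) - c * p 1) (at x)"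
      unfolding p_def by (rule derivative_eq_intros W_deriv refl x0)+ simp
    moreover have "p 1 * c \<le> p x * ((1 + c) * (u x + v x) - c)"
      using p_mono[of 1 x] p0[of 1] p0[of x] x coefficient_ge[of x] u.c by (intro mult_mono) auto
    ultimately show "\<exists>y. ((\<lambda>x. W x - c * p 1 * x) has_real_derivative y) (at x) \<and> 0 \<le> y"
      by (intro exI conjI) (auto simp: mult_ac)
  qed simp
  with W1 show ?thesis by simp
qed

text \<open>(u / v)' = W / (r^2 v^2), and W does not decrease beyond a as long as d >= 0, since its
  remaining factor is nonnegative by \<open>coefficient_ge\<close>.\<close>

lemma ratio_uv_mono:
  assumes "1 \<le> a" "0 \<le> W a" "a \<le> x" "x \<le> y" and pos: "\<And>z. a < z \<Longrightarrow> z < y \<Longrightarrow> 0 \<le> d z"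
  shows "u x / v x \<le> u y / v y"
proof -
  have W: "0 \<le> W z" if z: "a \<le> z" "z \<le> y" for z
  proof -
    have "W a \<le> W z"
    proof (cases "a = z")
      case False
      then have "a < z" using z by simp
      show ?thesis
      proof (rule DERIV_nonneg_imp_increasing_open[of a z W])
        fix w assume w: "a < w" "w < z"
        have "0 \<le> (w\<^sup>2 * u w * v w * d w) * ((1 + c) * (u w + v w) - c)"
          using w z assms pos[of w] u.nonneg[of w] v.nonneg[of w] coefficient_ge[of w] u.c
          by (intro mult_nonneg_nonneg) auto
        then show "\<exists>l. (W has_real_derivative l) (at w) \<and> 0 \<le> l"
          using W_deriv[of w] w assms by auto
      qed (use z W_cont assms in auto)
    qed simp
    with assms show ?thesis by simp
  qed
  show ?thesis
  proof (rule DERIV_nonneg_imp_nondecreasing[OF \<open>x \<le> y\<close>])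
    fix z assume z: "x \<le> z" "z \<le> y"
    then have z0: "0 < z" using assms by simp
    have v0: "v z > 0" using v.positive[OF z0] .
    have "((\<lambda>z. u z / v z) has_real_derivative W z / (z\<^sup>2 * (v z)\<^sup>2)) (at z)"
      unfolding W_def
      by (rule derivative_eq_intros u.deriv v.deriv refl z0)+
        (use z0 v0 in \<open>auto simp: field_simps power2_eq_square\<close>)
    moreover have "0 \<le> W z / (z\<^sup>2 * (v z)\<^sup>2)" using W[of z] z assms by simp
    ultimately show "\<exists>l. ((\<lambda>z. u z / v z) has_real_derivative l) (at z) \<and> 0 \<le> l" by blast
  qed
qed

text \<open>If d is positive on all of [2,x], then a = 2 works by \<open>W_2_nonneg\<close>.
  Otherwise a is the last zero of d before x; there W reduces to a^2 v d', and d' >= 0 because d is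
  positive to the right.\<close>

lemma start_point:
  assumes "2 \<le> x" "0 < d x"
  obtains a where "2 \<le> a" "a \<le> x" "0 \<le> W a" "\<And>z. a < z \<Longrightarrow> z \<le> x \<Longrightarrow> 0 < d z"
proof (cases "0 < d 2 \<and> (\<forall>z. 2 < z \<and> z \<le> x \<longrightarrow> 0 < d z)")
  case True
  then show ?thesis using that[of 2] W_2_nonneg assms by auto
next
  case False
  then have "\<exists>y\<in>{2..x}. d y \<le> 0" using \<open>2 \<le> x\<close> by (force simp: not_less)
  then obtain y where y: "2 \<le> y" "y \<le> x" "d y \<le> 0" by auto
  obtain a where a: "y \<le> a" "a < x" "d a = 0" "\<And>z. a < z \<Longrightarrow> z \<le> x \<Longrightarrow> 0 < d z"
    using last_zero[OF d_cont, of y x] y assms by auto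
  have a0: "0 < a" using a y by simp
  have "0 \<le> d' a"
  proof (rule ccontr)
    assume "\<not> 0 \<le> d' a"
    then obtain e where e: "e > 0" "\<And>h. 0 < h \<Longrightarrow> h < e \<Longrightarrow> d (a + h) < d a"
      using DERIV_neg_dec_right[OF d_deriv[OF a0]] by auto
    define h where "h = min (e / 2) (x - a)"
    have h: "0 < h" "h < e" "h \<le> x - a" using e a by (auto simp: h_def)
    show False using e(2)[OF h(1,2)] a(3) a(4)[of "a + h"] h by simp
  qed
  moreover have "W a = a\<^sup>2 * v a * d' a"
    using a(3) by (simp add: W_def d_def d'_def algebra_simps)
  ultimately have "0 \<le> W a" using v.nonneg[OF a0] by simp
  then show ?thesis using that[of a] a y by auto
qed

lemma not_greater:
  assumes "0 < r"
  shows "u r \<le> v r"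
proof (rule ccontr)
  assume "\<not> u r \<le> v r"
  then have dr: "0 < d r" by (simp add: d_def)
  define x where "x = max r 2"
  have x: "2 \<le> x" "0 < d x"
    using d_pos_forward[of r 2] dr assms by (auto simp: x_def max_def)
  have gt1: "1 < u x / v x" using x v.positive[of x] by (simp add: d_def)
  obtain a where a: "2 \<le> a" "a \<le> x" "0 \<le> W a" "\<And>z. a < z \<Longrightarrow> z \<le> x \<Longrightarrow> 0 < d z"
    using start_point[OF x] by blast
  \<comment> \<open>At a first zero b of d the ratio u / v would be 1, although it has not decreased
    since x, where it exceeds 1.\<close>
  have pos: "0 < d y" if xy: "x \<le> y" for y
  proof (rule ccontr)
    assume "\<not> 0 < d y"
    then obtain b where b: "x < b" "d b = 0" "\<And>z. x \<le> z \<Longrightarrow> z < b \<Longrightarrow> 0 < d z"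
      using first_zero[of x y d, OF d_cont[of x y] xy \<open>0 < d x\<close>] x(1) by auto
    have "0 \<le> d z" if "a < z" "z < b" for z
      using a(4)[of z] b(3)[of z] that by (cases "z \<le> x") auto
    then have "u x / v x \<le> u b / v b"
      using a b x by (intro ratio_uv_mono[of a]) auto
    moreover have "u b / v b = 1" using b x v.positive[of b] by (simp add: d_def)
    ultimately show False using gt1 by simp
  qed
  have ge: "u x / v x \<le> u y / v y" if "x \<le> y" for y
  proof -
    have "0 \<le> d z" if "a < z" for z
      using a(4)[of z] pos[of z] that by (cases "z \<le> x") auto
    then show ?thesis using a x that by (intro ratio_uv_mono[of a]) auto
  qed
  have "((\<lambda>y. u y / v y) \<longlongrightarrow> 1 / 1) at_top"
    by (intro tendsto_divide u.tendsto_1 v.tendsto_1) simp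
  moreover have "\<forall>\<^sub>F y in at_top. u x / v x \<le> u y / v y"
    using ge unfolding eventually_at_top_linorder by blast
  ultimately have "u x / v x \<le> 1 / 1"
    by (rule tendsto_lowerbound) simp
  with gt1 show False by simp
qed

end

lemma profile_unique:
  assumes "hedgehog_profile c u u'" "hedgehog_profile c v v'" "c \<le> 1 / 500" "0 < r"
  shows "u r = v r"
proof -
  interpret two_profiles c u u' v v'
    using assms by (intro two_profiles.intro two_profiles_axioms.intro)
  interpret sw: two_profiles c v v' u u' by (rule swap)
  show ?thesis using not_greater sw.not_greater assms(4) by (intro antisym)
qed

section \<open>The initial value problem at the origin\<close>

definition clamp01 :: "real \<Rightarrow> real" where
  "clamp01 x = max 0 (min 1 x)"

text \<open>The truncated nonlinearity divided by s^2, arranged without a division so that it is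
  continuous up to s = 0. Leaving max 0 w uncapped above is harmless: where s^2 w > 1 the first
  factor vanishes.\<close>

definition source :: "real \<Rightarrow> real \<Rightarrow> real \<Rightarrow> real" where
  "source c s w = (clamp01 (s\<^sup>2 * w) - 1) * (1 + (1 + c) * clamp01 (s\<^sup>2 * w)) * max 0 w"

lemma clamp01_bounds: "0 \<le> clamp01 x" "clamp01 x \<le> 1"
  by (auto simp: clamp01_def)

lemma clamp01_id: "0 \<le> x \<Longrightarrow> x \<le> 1 \<Longrightarrow> clamp01 x = x"
  by (simp add: clamp01_def)

lemma clamp01_lipschitz: "\<bar>clamp01 x - clamp01 y\<bar> \<le> \<bar>x - y\<bar>"
  by (auto simp: clamp01_def)

lemma scaled_source: "s\<^sup>2 * source c s w = cubic c (clamp01 (s\<^sup>2 * w))"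
proof -
  consider "s = 0" | "s \<noteq> 0" "w \<le> 0" | "s \<noteq> 0" "0 < w" "s\<^sup>2 * w \<le> 1" | "1 < s\<^sup>2 * w" by linarith
  then show ?thesis
  proof cases
    case 2
    then have "s\<^sup>2 * w \<le> 0" by (simp add: mult_nonneg_nonpos)
    with 2 show ?thesis by (simp add: source_def clamp01_def cubic_factor)
  next
    case 3
    then have "0 \<le> s\<^sup>2 * w" by simp
    with 3 show ?thesis by (simp add: source_def clamp01_id cubic_factor)
  qed (auto simp: source_def clamp01_def cubic_factor)
qed

lemma cubic_lipschitz:
  assumes "0 \<le> c" "c \<le> 1 / 4" "0 \<le> x" "x \<le> 1" "0 \<le> y" "y \<le> 1"
  shows "\<bar>cubic c x - cubic c y\<bar> \<le> 3 * \<bar>x - y\<bar>"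
proof -
  define V where "V = (1 + c) * (x * x + x * y + y * y) - c * (x + y) - 1"
  have "cubic c x - cubic c y = V * (x - y)"
    by (simp add: cubic_def V_def algebra_simps power2_eq_square power3_eq_cube)
  moreover have "\<bar>V\<bar> \<le> 3"
  proof -
    have "x * x \<le> 1" "x * y \<le> 1" "y * y \<le> 1" using assms by (auto intro: mult_le_one)
    then have "(1 + c) * (x * x + x * y + y * y) \<le> (5 / 4) * 3"
      using assms by (intro mult_mono) auto
    moreover have "c * (x + y) \<le> 1 / 4 * 2" using assms by (intro mult_mono) auto
    moreover have "0 \<le> (1 + c) * (x * x + x * y + y * y)" "0 \<le> c * (x + y)" using assms by auto
    ultimately show ?thesis unfolding V_def by linarith
  qed
  ultimately show ?thesis by (simp add: abs_mult mult_right_mono)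
qed

text \<open>The factor s^2 in h = s^2 w cancels the division by s^2, so the Lipschitz constant of
  \<open>cubic\<close> on [0,1] carries over uniformly in s.\<close>

lemma source_lipschitz:
  assumes "0 \<le> c" "c \<le> 1 / 4"
  shows "\<bar>source c s a - source c s b\<bar> \<le> 3 * \<bar>a - b\<bar>"
proof (cases "s = 0")
  case True
  then show ?thesis by (auto simp: source_def clamp01_def max_def abs_if)
next
  case False
  have "s\<^sup>2 * \<bar>source c s a - source c s b\<bar> = \<bar>s\<^sup>2 * source c s a - s\<^sup>2 * source c s b\<bar>"
    by (simp add: right_diff_distrib[symmetric] abs_mult)
  also have "\<dots> \<le> 3 * \<bar>clamp01 (s\<^sup>2 * a) - clamp01 (s\<^sup>2 * b)\<bar>"
    unfolding scaled_source by (intro cubic_lipschitz assms clamp01_bounds)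
  also have "\<dots> \<le> 3 * \<bar>s\<^sup>2 * a - s\<^sup>2 * b\<bar>" using clamp01_lipschitz by simp
  also have "\<dots> = s\<^sup>2 * (3 * \<bar>a - b\<bar>)" by (simp add: right_diff_distrib[symmetric] abs_mult)
  finally show ?thesis using False by simp
qed

lemma source_bounds:
  assumes "0 \<le> c" "c \<le> 1 / 4"
  shows "source c s w \<le> 0" "- (5 / 4 * max 0 w) \<le> source c s w"
proof -
  define x where "x = clamp01 (s\<^sup>2 * w)"
  have x: "0 \<le> x" "x \<le> 1" using clamp01_bounds by (auto simp: x_def)
  have "c * x * (1 - x) \<le> 1/4 * 1 * 1" using assms x by (intro mult_mono) auto
  moreover have "0 \<le> x * x" by simp
  moreover have "(1 - x) * (1 + (1 + c) * x) = 1 + c * x * (1 - x) - x * x"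
    by (simp add: algebra_simps)
  ultimately have "(1 - x) * (1 + (1 + c) * x) \<le> 5 / 4" by linarith
  then have "(1 - x) * (1 + (1 + c) * x) * max 0 w \<le> 5 / 4 * max 0 w"
    by (intro mult_right_mono) auto
  moreover have "0 \<le> (1 - x) * (1 + (1 + c) * x) * max 0 w" using x assms by simp
  moreover have "source c s w = - ((1 - x) * (1 + (1 + c) * x) * max 0 w)"
    by (simp add: source_def x_def algebra_simps)
  ultimately show "source c s w \<le> 0" "- (5 / 4 * max 0 w) \<le> source c s w" by linarith+
qed

lemma source_cont:
  assumes "continuous_on S w"
  shows "continuous_on S (\<lambda>s. source c s (w s))"
  unfolding source_def clamp01_def by (intro continuous_intros assms)

text \<open>Inverts \<open>w'' + 6 w' / r = g\<close> with \<open>w 0 = 0\<close>; the kernel comes from writing the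
  equation as \<open>(r^6 w')' = r^6 g\<close> and integrating twice.\<close>

definition radial_int :: "(real \<Rightarrow> real) \<Rightarrow> real \<Rightarrow> real" where
  "radial_int g r = integral {0..r} (\<lambda>s. (s - s ^ 6 / r ^ 5) / 5 * g s)"

text \<open>The kernel lies between 0 and s / 5, and the integral of s / 5 * exp (s^2) is (exp (r^2)
  - 1) / 10. In the weighted norm the operator gains 1 / 10, enough against the Lipschitz constant
  3.\<close>

lemma radial_int_bound:
  assumes g: "continuous_on {0..} g" and K: "0 \<le> K" "\<And>s. 0 \<le> s \<Longrightarrow> \<bar>g s\<bar> \<le> K * exp (s\<^sup>2)"
    and r: "0 \<le> r"
  shows "\<bar>radial_int g r\<bar> \<le> K / 10 * (exp (r\<^sup>2) - 1)"
proof (cases "r = 0")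
  case True
  then show ?thesis by (simp add: radial_int_def)
next
  case False
  with r have r: "0 < r" by simp
  have g': "continuous_on {0..r} g" by (rule continuous_on_subset[OF g]) auto
  have hi: "((\<lambda>s. s / 5 * (K * exp (s\<^sup>2))) has_integral
      K / 10 * exp (r\<^sup>2) - K / 10 * exp (0\<^sup>2)) {0..r}"
    using r by (intro fundamental_theorem_of_calculus)
      (auto simp flip: has_real_derivative_iff_has_vector_derivative intro!: derivative_eq_intros)
  have "norm (radial_int g r) \<le> integral {0..r} (\<lambda>s. s / 5 * (K * exp (s\<^sup>2)))"
    unfolding radial_int_def
  proof (rule integral_norm_bound_integral)
    show "(\<lambda>s. (s - s ^ 6 / r ^ 5) / 5 * g s) integrable_on {0..r}"
      by (intro integrable_continuous_real continuous_intros g') (use r in auto)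
    show "(\<lambda>s. s / 5 * (K * exp (s\<^sup>2))) integrable_on {0..r}"
      using hi by blast
    fix s assume s: "s \<in> {0..r}"
    have "s ^ 5 \<le> r ^ 5" using s by (intro power_mono) auto
    then have "s ^ 5 / r ^ 5 \<le> 1" using r by simp
    then have "s * (s ^ 5 / r ^ 5) \<le> s * 1" using s by (intro mult_left_mono) auto
    then have "s ^ 6 / r ^ 5 \<le> s" by (simp add: eval_nat_numeral)
    moreover have "0 \<le> s ^ 6 / r ^ 5" using s r by simp
    moreover have "\<bar>(s - t) / 5\<bar> \<le> s / 5" if "0 \<le> t" "t \<le> s" for t
      using that by simp
    ultimately have "\<bar>(s - s ^ 6 / r ^ 5) / 5\<bar> \<le> s / 5" by blast
    then have "\<bar>(s - s ^ 6 / r ^ 5) / 5\<bar> * \<bar>g s\<bar> \<le> s / 5 * (K * exp (s\<^sup>2))"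
      using K(2)[of s] s by (intro mult_mono) auto
    then show "norm ((s - s ^ 6 / r ^ 5) / 5 * g s) \<le> s / 5 * (K * exp (s\<^sup>2))"
      by (simp add: abs_mult)
  qed
  also have "\<dots> = K / 10 * (exp (r\<^sup>2) - 1)"
    using integral_unique[OF hi] by (simp add: algebra_simps)
  finally show ?thesis by simp
qed

lemma integral_deriv:
  fixes f :: "real \<Rightarrow> real"
  assumes f: "continuous_on {0..} f" and r: "0 < r"
  shows "((\<lambda>r. integral {0..r} f) has_real_derivative f r) (at r)"
proof -
  have "continuous_on {0..r + 1} f" by (rule continuous_on_subset[OF f]) auto
  then have "((\<lambda>r. integral {0..r} f) has_real_derivative f r) (at r within {0..r + 1})"
    using r by (intro integral_has_real_derivative) auto
  then show ?thesis using r by (simp add: at_within_Icc_at)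
qed

text \<open>Splitting the kernel separates the dependence on r into moments of g. The boundary terms
  cancel since the kernel vanishes at s = r.\<close>

lemma radial_int_deriv:
  assumes g: "continuous_on {0..} g" and r: "0 < r"
  shows "(radial_int g has_real_derivative integral {0..r} (\<lambda>s. s ^ 6 * g s) / r ^ 6) (at r)"
proof -
  have cg: "continuous_on {0..} (\<lambda>s. s ^ k * g s)" for k by (intro continuous_intros g)
  define M where "M = (\<lambda>k r. integral {0..r} (\<lambda>s. s ^ k * g s))"
  have M: "(M k has_real_derivative r ^ k * g r) (at r)" for k
    unfolding M_def using integral_deriv[OF cg r] .
  have eq: "(M 1 x - M 6 x / x ^ 5) / 5 = radial_int g x" if "0 < x" for x
  proof -
    have int: "(\<lambda>s. s ^ k * g s) integrable_on {0..x}" for k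
      by (rule integrable_continuous_real, rule continuous_on_subset[OF cg]) auto
    have "radial_int g x = integral {0..x} (\<lambda>s. (s ^ 1 * g s) / 5 - (s ^ 6 * g s) / (5 * x ^ 5))"
      unfolding radial_int_def by (intro integral_cong) (simp add: field_simps)
    also have "\<dots> = integral {0..x} (\<lambda>s. s ^ 1 * g s) / 5 - integral {0..x} (\<lambda>s. s ^ 6 * g s) / (5 * x ^ 5)"
      using int[of 1] int[of 6] by (subst integral_diff) (auto intro: integrable_on_divide)
    finally show ?thesis by (simp add: M_def field_simps)
  qed
  have "((\<lambda>x. (M 1 x - M 6 x / x ^ 5) / 5) has_real_derivative M 6 r / r ^ 6) (at r)"
    by (rule derivative_eq_intros M refl | use r in \<open>simp; fail\<close>)+
      (use r in \<open>auto simp: field_simps eval_nat_numeral\<close>)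
  then have "(radial_int g has_real_derivative M 6 r / r ^ 6) (at r)"
    by (rule has_field_derivative_transform_within_open[where S = "{0<..}"]) (use r eq in auto)
  then show ?thesis by (simp add: M_def)
qed

lemma radial_int_cont:
  assumes g: "continuous_on {0..} g" and K: "0 \<le> K" "\<And>s. 0 \<le> s \<Longrightarrow> \<bar>g s\<bar> \<le> K * exp (s\<^sup>2)"
  shows "continuous_on {0..} (radial_int g)"
  unfolding continuous_on_eq_continuous_within
proof
  fix r :: real assume "r \<in> {0..}"
  then consider "0 < r" | "r = 0" by force
  then show "continuous (at r within {0..}) (radial_int g)"
  proof cases
    case 1
    then show ?thesis
      using radial_int_deriv[OF g] by (meson DERIV_isCont continuous_at_imp_continuous_at_within)
  next
    case 2
    have "(radial_int g \<longlongrightarrow> 0) (at 0 within {0..})"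
    proof (rule tendsto_rabs_zero_cancel, rule tendsto_sandwich)
      show "\<forall>\<^sub>F s in at 0 within {0..}. 0 \<le> \<bar>radial_int g s\<bar>" by simp
      show "\<forall>\<^sub>F s in at 0 within {0..}. \<bar>radial_int g s\<bar> \<le> K / 10 * (exp (s\<^sup>2) - 1)"
        unfolding eventually_at_filter using radial_int_bound[OF g K] by simp
      have "((\<lambda>s::real. K / 10 * (exp (s\<^sup>2) - 1)) \<longlongrightarrow> K / 10 * (exp (0\<^sup>2) - 1)) (at 0 within {0..})"
        by (intro tendsto_intros)
      then show "((\<lambda>s::real. K / 10 * (exp (s\<^sup>2) - 1)) \<longlongrightarrow> 0) (at 0 within {0..})" by simp
    qed simp
    then show ?thesis using 2 by (simp add: continuous_within radial_int_def)
  qed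
qed

lemma radial_int_diff:
  assumes "continuous_on {0..} f" "continuous_on {0..} g" "0 \<le> r"
  shows "radial_int f r - radial_int g r = radial_int (\<lambda>s. f s - g s) r"
proof (cases "r = 0")
  case True
  then show ?thesis by (simp add: radial_int_def)
next
  case False
  have int: "(\<lambda>s. (s - s ^ 6 / r ^ 5) / 5 * f s) integrable_on {0..r}"
    if "continuous_on {0..} f" for f
    by (intro integrable_continuous_real continuous_intros continuous_on_subset[OF that])
      (use False in auto)
  show ?thesis
    unfolding radial_int_def right_diff_distrib
    by (rule integral_diff[symmetric]) (intro int assms)+
qed

text \<open>The weight \<open>exp (r^2)\<close> makes the integral operator a contraction on the whole half-line.
  The evaluation at \<open>\<bar>r\<bar>\<close> only serves to have functions defined on all reals.\<close>

lemma fixed_points: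
  assumes c: "0 \<le> c" "c \<le> 1 / 4"
  shows "\<exists>w :: real \<Rightarrow> real \<Rightarrow> real.
    (\<forall>A. continuous_on {0..} (w A) \<and>
      (\<forall>r\<ge>0. w A r = A + radial_int (\<lambda>s. source c s (w A s)) r)) \<and>
    (\<forall>r\<ge>0. continuous_on UNIV (\<lambda>A. w A r))"
proof -
  \<comment> \<open>The unknown in the Banach space is u = w exp (- r^2), so that the supremum norm
    of u is the weighted norm of w.\<close>
  define g :: "(real \<Rightarrow>\<^sub>C real) \<Rightarrow> real \<Rightarrow> real"
    where "g = (\<lambda>u s. source c s (apply_bcontfun u s * exp (s\<^sup>2)))"
  have gc: "continuous_on S (g u)" for S u
    unfolding g_def by (intro source_cont continuous_intros) auto
  have gb: "\<bar>g u s\<bar> \<le> 3 * norm u * exp (s\<^sup>2)" for u s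
  proof -
    have "\<bar>g u s\<bar> \<le> 3 * \<bar>apply_bcontfun u s * exp (s\<^sup>2)\<bar>"
      using source_lipschitz[OF c, of s "apply_bcontfun u s * exp (s\<^sup>2)" 0]
      by (simp add: g_def source_def)
    also have "\<dots> \<le> 3 * (norm u * exp (s\<^sup>2))"
      using norm_bounded[of u s] by (simp add: abs_mult mult_right_mono)
    finally show ?thesis by simp
  qed
  have gd: "\<bar>g u s - g v s\<bar> \<le> 3 * dist u v * exp (s\<^sup>2)" for u v s
  proof -
    have "\<bar>g u s - g v s\<bar> \<le> 3 * \<bar>apply_bcontfun u s * exp (s\<^sup>2) - apply_bcontfun v s * exp (s\<^sup>2)\<bar>"
      unfolding g_def by (rule source_lipschitz[OF c])
    also have "\<dots> = 3 * (dist (apply_bcontfun u s) (apply_bcontfun v s) * exp (s\<^sup>2))"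
      by (simp add: dist_real_def left_diff_distrib[symmetric] abs_mult)
    also have "\<dots> \<le> 3 * (dist u v * exp (s\<^sup>2))"
      using dist_bounded[of u s v] by (simp add: mult_right_mono)
    finally show ?thesis by simp
  qed
  define T where "T = (\<lambda>A u r. (A + radial_int (g u) \<bar>r\<bar>) * exp (- (r\<^sup>2)))"
  have Tc: "T A u \<in> bcontfun" for A u
  proof (rule bcontfun_normI)
    have "continuous_on UNIV (\<lambda>r. radial_int (g u) \<bar>r\<bar>)"
      by (rule continuous_on_compose2[OF radial_int_cont[OF gc _ gb]]) (auto intro: continuous_intros)
    then show "continuous_on UNIV (T A u)" unfolding T_def by (intro continuous_intros)
    fix r
    have "\<bar>radial_int (g u) \<bar>r\<bar>\<bar> \<le> 3 * norm u / 10 * (exp (r\<^sup>2) - 1)"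
      using radial_int_bound[OF gc _ gb, of u "\<bar>r\<bar>"] by simp
    also have "\<dots> \<le> 3 * norm u / 10 * exp (r\<^sup>2)" by (intro mult_left_mono) auto
    finally have 1: "\<bar>radial_int (g u) \<bar>r\<bar>\<bar> \<le> 3 * norm u / 10 * exp (r\<^sup>2)" .
    have "\<bar>A\<bar> * 1 \<le> \<bar>A\<bar> * exp (r\<^sup>2)" by (intro mult_left_mono) auto
    with 1 have "\<bar>A + radial_int (g u) \<bar>r\<bar>\<bar> \<le> (\<bar>A\<bar> + 3 * norm u / 10) * exp (r\<^sup>2)"
      by (simp add: distrib_right)
    then show "norm (T A u r) \<le> \<bar>A\<bar> + 3 * norm u / 10"
      by (simp add: T_def abs_mult exp_minus field_simps)
  qed
  define \<Phi> where "\<Phi> = (\<lambda>A u. Bcontfun (T A u))"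
  have \<Phi>: "apply_bcontfun (\<Phi> A u) r = T A u r" for A u r
    by (simp add: \<Phi>_def Bcontfun_inverse[OF Tc])
  \<comment> \<open>One estimate for both purposes: A = B gives the contraction, and two fixed
    points give Lipschitz dependence on A with constant 1 / (1 - 3 / 10) = 10 / 7.\<close>
  have \<Phi>d: "dist (\<Phi> A u) (\<Phi> B v) \<le> \<bar>A - B\<bar> + 3 / 10 * dist u v" for A B u v
  proof (rule dist_bound)
    fix r
    have "\<bar>radial_int (g u) \<bar>r\<bar> - radial_int (g v) \<bar>r\<bar>\<bar> \<le> 3 * dist u v / 10 * (exp (r\<^sup>2) - 1)"
      using radial_int_bound[of "\<lambda>s. g u s - g v s" "3 * dist u v" "\<bar>r\<bar>"]
        radial_int_diff[OF gc gc, of "\<bar>r\<bar>" u v] gd continuous_on_diff[OF gc gc] by simp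
    also have "\<dots> \<le> 3 * dist u v / 10 * exp (r\<^sup>2)" by (intro mult_left_mono) auto
    finally have 1: "\<bar>radial_int (g u) \<bar>r\<bar> - radial_int (g v) \<bar>r\<bar>\<bar> \<le> 3 * dist u v / 10 * exp (r\<^sup>2)" .
    have "\<bar>A - B\<bar> * 1 \<le> \<bar>A - B\<bar> * exp (r\<^sup>2)" by (intro mult_left_mono) auto
    moreover have "\<bar>(A + x) - (B + y)\<bar> \<le> \<bar>A - B\<bar> + \<bar>x - y\<bar>" for x y by linarith
    ultimately have "\<bar>(A + radial_int (g u) \<bar>r\<bar>) - (B + radial_int (g v) \<bar>r\<bar>)\<bar>
        \<le> \<bar>A - B\<bar> * exp (r\<^sup>2) + 3 * dist u v / 10 * exp (r\<^sup>2)"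
      using 1 by (smt (verit))
    then have "\<bar>(A + radial_int (g u) \<bar>r\<bar>) - (B + radial_int (g v) \<bar>r\<bar>)\<bar>
        \<le> (\<bar>A - B\<bar> + 3 / 10 * dist u v) * exp (r\<^sup>2)"
      by (simp add: distrib_right)
    moreover have "\<bar>T A u r - T B v r\<bar> * exp (r\<^sup>2)
        = \<bar>(A + radial_int (g u) \<bar>r\<bar>) - (B + radial_int (g v) \<bar>r\<bar>)\<bar>"
      by (simp add: T_def left_diff_distrib[symmetric] abs_mult exp_minus)
    ultimately have "\<bar>T A u r - T B v r\<bar> * exp (r\<^sup>2)
        \<le> (\<bar>A - B\<bar> + 3 / 10 * dist u v) * exp (r\<^sup>2)" by simp
    then have "\<bar>T A u r - T B v r\<bar> \<le> \<bar>A - B\<bar> + 3 / 10 * dist u v"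
      by (rule mult_right_le_imp_le) simp
    then show "dist (apply_bcontfun (\<Phi> A u) r) (apply_bcontfun (\<Phi> B v) r)
        \<le> \<bar>A - B\<bar> + 3 / 10 * dist u v"
      by (simp add: \<Phi> dist_real_def)
  qed
  have "\<exists>!u. \<Phi> A u = u" for A
    using \<Phi>d[of A _ A] by (intro banach_fix_type[of "3 / 10"]) auto
  then obtain U where U: "\<And>A. \<Phi> A (U A) = U A" by metis
  have Ud: "dist (U A) (U B) \<le> 10 / 7 * \<bar>A - B\<bar>" for A B
    using \<Phi>d[of A "U A" B "U B"] by (simp add: U)
  define w where "w = (\<lambda>A r. apply_bcontfun (U A) r * exp (r\<^sup>2))"
  have gw: "g (U A) = (\<lambda>s. source c s (w A s))" for A by (simp add: g_def w_def)
  show ?thesis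
  proof (intro exI[of _ w] conjI allI impI)
    show "continuous_on {0..} (w A)" for A unfolding w_def by (intro continuous_intros) auto
    show "w A r = A + radial_int (\<lambda>s. source c s (w A s)) r" if "0 \<le> r" for A r
    proof -
      have "w A r = T A (U A) r * exp (r\<^sup>2)" unfolding w_def by (metis U \<Phi>)
      also have "\<dots> = A + radial_int (g (U A)) r" using that by (simp add: T_def exp_minus)
      finally show ?thesis by (simp add: gw)
    qed
    show "continuous_on UNIV (\<lambda>A. w A r)" if "0 \<le> r" for r
    proof -
      have Ur: "dist (apply_bcontfun (U B) r) (apply_bcontfun (U A) r) \<le> 10 / 7 * \<bar>B - A\<bar>" for A B
        by (rule order_trans[OF dist_bounded Ud])
      have "continuous_on UNIV (\<lambda>A. apply_bcontfun (U A) r)"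
        unfolding continuous_on_iff
      proof (intro ballI allI impI)
        fix A e :: real assume "0 < e"
        then show "\<exists>d>0. \<forall>B\<in>UNIV. dist B A < d \<longrightarrow>
            dist (apply_bcontfun (U B) r) (apply_bcontfun (U A) r) < e"
          by (intro exI[of _ "7 / 10 * e"])
            (auto simp: dist_real_def[of _ A] intro!: le_less_trans[OF Ur])
      qed
      then show ?thesis unfolding w_def by (intro continuous_intros)
    qed
  qed
qed

section \<open>Shooting\<close>

locale truncated_solution =
  fixes c A :: real and w :: "real \<Rightarrow> real"
  assumes c: "0 \<le> c" "c \<le> 1 / 4" and A: "0 < A"
    and w_cont: "continuous_on {0..} w"
    and w_eq: "0 \<le> r \<Longrightarrow> w r = A + radial_int (\<lambda>s. source c s (w s)) r"
begin

text \<open>This is r^6 w', the analogue of \<open>flux\<close> for the truncated equation.\<close>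

definition P :: "real \<Rightarrow> real" where
  "P r = integral {0..r} (\<lambda>s. s ^ 6 * source c s (w s))"

definition h :: "real \<Rightarrow> real" where "h r = r\<^sup>2 * w r"

definition h' :: "real \<Rightarrow> real" where "h' r = 2 * r * w r + P r / r ^ 4"

lemma w_0: "w 0 = A"
  using w_eq[of 0] by (simp add: radial_int_def)

lemma integrand_cont: "continuous_on {0..} (\<lambda>s. s ^ 6 * source c s (w s))"
  by (intro continuous_intros source_cont w_cont)

lemma integrand_integrable: "(\<lambda>s. s ^ 6 * source c s (w s)) integrable_on {0..r}"
  by (intro integrable_continuous_real continuous_on_subset[OF integrand_cont]) auto

lemma w_deriv:
  assumes "0 < r"
  shows "(w has_real_derivative P r / r ^ 6) (at r)"
proof -
  have "((\<lambda>r. A + radial_int (\<lambda>s. source c s (w s)) r) has_real_derivative 0 + P r / r ^ 6) (at r)"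
    unfolding P_def by (intro DERIV_add DERIV_const radial_int_deriv source_cont w_cont assms)
  then have "(w has_real_derivative 0 + P r / r ^ 6) (at r)"
    by (rule has_field_derivative_transform_within_open[where S = "{0<..}"])
      (use assms in \<open>auto simp: w_eq[symmetric]\<close>)
  then show ?thesis by simp
qed

lemma P_deriv: "0 < r \<Longrightarrow> (P has_real_derivative r ^ 6 * source c r (w r)) (at r)"
  unfolding P_def by (rule integral_deriv[OF integrand_cont])

lemma P_antimono:
  assumes "0 < r" "r \<le> s"
  shows "P s \<le> P r"
proof (rule DERIV_nonpos_imp_nonincreasing[OF assms(2)])
  fix x assume "r \<le> x" "x \<le> s"
  then have "0 < x" using assms by simp
  moreover have "x ^ 6 * source c x (w x) \<le> 0"
    using source_bounds(1)[OF c] \<open>0 < x\<close> by (intro mult_nonneg_nonpos) auto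
  ultimately show "\<exists>y. (P has_real_derivative y) (at x) \<and> y \<le> 0" using P_deriv by blast
qed

lemma P_nonpos: "P r \<le> 0"
proof -
  have "P r \<le> integral {0..r} (\<lambda>_. 0)"
    unfolding P_def using source_bounds(1)[OF c]
    by (intro integral_le integrand_integrable) (auto intro: mult_nonneg_nonpos)
  then show ?thesis by simp
qed

lemma w_antimono:
  assumes "0 \<le> r" "r \<le> s"
  shows "w s \<le> w r"
proof (rule DERIV_nonpos_imp_decreasing_open[OF assms(2)])
  fix x assume "r < x" "x < s"
  then have "0 < x" using assms by simp
  then show "\<exists>y. (w has_real_derivative y) (at x) \<and> y \<le> 0"
    using w_deriv P_nonpos by (meson divide_nonpos_pos zero_less_power)
next
  show "continuous_on {r..s} w" by (rule continuous_on_subset[OF w_cont]) (use assms in auto)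
qed

lemma w_le: "0 \<le> r \<Longrightarrow> w r \<le> A"
  using w_antimono[of 0 r] w_0 by simp

lemma P_ge:
  assumes "0 < r"
  shows "- (5 / 28 * A * r ^ 7) \<le> P r"
proof -
  have hi: "((\<lambda>s. s ^ 6 * - (5 / 4 * A)) has_integral - (5 / 28 * A * r ^ 7) - - (5 / 28 * A * 0 ^ 7)) {0..r}"
    using assms by (intro fundamental_theorem_of_calculus)
      (auto simp flip: has_real_derivative_iff_has_vector_derivative intro!: derivative_eq_intros)
  have "integral {0..r} (\<lambda>s. s ^ 6 * - (5 / 4 * A)) \<le> P r"
    unfolding P_def
  proof (rule integral_le)
    show "(\<lambda>s. s ^ 6 * - (5 / 4 * A)) integrable_on {0..r}" using hi by blast
    show "(\<lambda>s. s ^ 6 * source c s (w s)) integrable_on {0..r}" by (rule integrand_integrable)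
    fix s assume "s \<in> {0..r}"
    then have "max 0 (w s) \<le> A" using w_le[of s] A by auto
    then have "- (5 / 4 * A) \<le> source c s (w s)" using source_bounds(2)[OF c, of "w s" s] by linarith
    then show "s ^ 6 * - (5 / 4 * A) \<le> s ^ 6 * source c s (w s)" by (intro mult_left_mono) auto
  qed
  then show ?thesis unfolding integral_unique[OF hi] by simp
qed

text \<open>Integrating w' >= - 5 / 28 A r from 0 to 1 loses at most 5 / 56 A. For A = 2 this gives
  h 1 = w 1 > 1, an overshoot.\<close>

lemma w_1_ge: "A * (51 / 56) \<le> w 1"
proof -
  have "w 0 + 5 / 56 * A * 0\<^sup>2 \<le> w 1 + 5 / 56 * A * 1\<^sup>2"
  proof (rule DERIV_nonneg_imp_increasing_open[of 0 1 "\<lambda>r. w r + 5 / 56 * A * r\<^sup>2"])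
    fix x :: real assume x: "0 < x" "x < 1"
    have "((\<lambda>r. w r + 5 / 56 * A * r\<^sup>2) has_real_derivative P x / x ^ 6 + 5 / 28 * A * x) (at x)"
      by (rule derivative_eq_intros w_deriv refl x)+ simp
    moreover have "- (5 / 28 * A * x) \<le> P x / x ^ 6"
      using P_ge[OF x(1)] x by (simp add: pos_le_divide_eq eval_nat_numeral mult_ac)
    ultimately show "\<exists>y. ((\<lambda>r. w r + 5 / 56 * A * r\<^sup>2) has_real_derivative y) (at x) \<and> 0 \<le> y"
      by (intro exI conjI) auto
  next
    show "continuous_on {0..1} (\<lambda>r. w r + 5 / 56 * A * r\<^sup>2)"
      by (intro continuous_intros continuous_on_subset[OF w_cont]) auto
  qed simp
  then show ?thesis by (simp add: w_0)
qed

lemma h_cont: "continuous_on {0..} h"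
  unfolding h_def by (intro continuous_intros w_cont)

lemma h_deriv: "0 < r \<Longrightarrow> (h has_real_derivative h' r) (at r)"
  unfolding h_def h'_def
  by (rule derivative_eq_intros w_deriv refl | assumption)+ (simp add: field_simps eval_nat_numeral)

lemma h_deriv2:
  assumes "0 < r"
  shows "(h' has_real_derivative (cubic c (clamp01 (h r)) + 6 * h r / r\<^sup>2 - 2 / r * h' r)) (at r)"
proof -
  have "(h' has_real_derivative 2 * w r + 2 * r * (P r / r ^ 6) +
      (r ^ 6 * source c r (w r) * r ^ 4 - P r * (4 * r ^ 3)) / (r ^ 4 * r ^ 4)) (at r)"
    unfolding h'_def
    by (rule derivative_eq_intros w_deriv P_deriv refl assms | use assms in \<open>simp; fail\<close>)+
  also have "2 * w r + 2 * r * (P r / r ^ 6) +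
      (r ^ 6 * source c r (w r) * r ^ 4 - P r * (4 * r ^ 3)) / (r ^ 4 * r ^ 4)
    = r\<^sup>2 * source c r (w r) + 6 * h r / r\<^sup>2 - 2 / r * h' r"
    using assms unfolding h_def h'_def by (simp add: field_simps eval_nat_numeral)
  finally show ?thesis by (simp add: scaled_source h_def)
qed

text \<open>Above 1 the truncated nonlinearity vanishes, so h'' = 6 h / r^2 > 0 at critical points
  and h has no interior maximum there. Having passed 1, h cannot come back.\<close>

lemma overshoot_persists:
  assumes "0 < r" "r \<le> s" "h s \<le> 1"
  shows "h r \<le> 1"
proof -
  have "h r - 1 \<le> 0"
  proof (rule no_interior_positive_max[where a = 0 and b = s and D = "\<lambda>r. h r - 1"
      and ?D1.0 = h' and ?D2.0 = "\<lambda>r. cubic c (clamp01 (h r)) + 6 * h r / r\<^sup>2 - 2 / r * h' r"])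
    show "continuous_on {0..s} (\<lambda>r. h r - 1)"
      by (intro continuous_intros continuous_on_subset[OF h_cont]) auto
    show "((\<lambda>r. h r - 1) has_real_derivative h' y) (at y)" if "0 < y" for y
      using DERIV_diff[OF h_deriv[OF that] DERIV_const[of 1]] by simp
    fix y assume "0 < y" "0 < h y - 1" "h' y = 0"
    then show "0 < cubic c (clamp01 (h y)) + 6 * h y / y\<^sup>2 - 2 / y * h' y"
      by (simp add: clamp01_def cubic_factor)
  qed (use assms h_deriv2 in \<open>auto simp: h_def\<close>)
  then show ?thesis by simp
qed

lemma w_pos:
  assumes nn: "\<And>r. 0 < r \<Longrightarrow> 0 \<le> w r" and r: "0 < r"
  shows "0 < w r"
proof (rule ccontr)
  assume "\<not> 0 < w r"
  then have "w r = 0" using nn[OF r] by simp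
  then have z: "w s = 0" if "0 < s" for s
    using zero_of_nonincreasing_flux[OF w_deriv P_antimono P_nonpos nn r _ that] by simp
  have "(w \<longlongrightarrow> w 0) (at_right 0)"
    using w_cont unfolding continuous_on
    by (metis atLeast_iff at_within_Ici_at_right order_refl)
  moreover have "(w \<longlongrightarrow> 0) (at_right 0)"
    by (rule tendsto_eventually) (use z in \<open>auto simp: eventually_at_filter\<close>)
  ultimately have "w 0 = 0" using tendsto_unique[OF trivial_limit_at_right_real] by blast
  then show False using w_0 A by simp
qed

text \<open>Otherwise w > 0, and w <= A gives 0 < h <= 121 / 500 < 1 / 4 on [7,11]. The truncation
  is inactive there, and \<open>sturm_not_small\<close> is contradicted.\<close>

lemma negative_somewhere:
  assumes "A \<le> 1 / 500"
  shows "\<exists>r>0. w r < 0"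
proof (rule ccontr)
  assume "\<not> ?thesis"
  then have pos: "0 < w r" if "0 < r" for r using w_pos that by (meson not_less)
  have small: "h r \<le> 1 / 4" if "7 \<le> r" "r \<le> 7 + 5 * pi / 4" for r
  proof -
    have "r \<le> 11" using that pi_approx by simp
    then have "r\<^sup>2 \<le> 11\<^sup>2" using that by (intro power_mono) auto
    then have "r\<^sup>2 * w r \<le> 11\<^sup>2 * (1 / 500)"
      using w_le[of r] pos[of r] that assms by (intro mult_mono) auto
    then show ?thesis by (simp add: h_def)
  qed
  have hpos: "0 < h r" if "0 < r" for r using pos[OF that] that by (simp add: h_def)
  have "\<exists>r. 7 \<le> r \<and> r \<le> 7 + 5 * pi / 4 \<and> 1 / 4 < h r"
  proof (rule sturm_not_small[OF c(1)])
    fix r :: real assume r: "7 \<le> r" "r \<le> 7 + 5 * pi / 4"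
    show "(h has_real_derivative h' r) (at r)" using h_deriv r by simp
    show "(h' has_real_derivative cubic c (h r) + 6 * h r / r\<^sup>2 - 2 / r * h' r) (at r)"
      using h_deriv2[of r] small[OF r] hpos[of r] r by (simp add: clamp01_id)
    show "0 < h r" using hpos r by simp
  qed simp
  then show False using small by (meson not_less)
qed

lemma profile:
  assumes "\<And>r. 0 < r \<Longrightarrow> 0 \<le> w r" "\<And>r. 0 < r \<Longrightarrow> h r \<le> 1"
  shows "hedgehog_profile c h h'"
proof
  show "(h \<longlongrightarrow> 0) (at_right 0)"
    using h_cont unfolding continuous_on
    by (metis atLeast_iff at_within_Ici_at_right h_def mult_zero_left order_refl zero_power2)
  show "\<exists>r>0. h r \<noteq> 0"
    using w_pos[OF assms(1), of 1] by (intro exI[of _ 1]) (auto simp: h_def)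
  fix r :: real assume r: "0 < r"
  show h0: "0 \<le> h r" using assms(1)[OF r] by (simp add: h_def)
  show "h r \<le> 1" using assms(2)[OF r] .
  show "(h has_real_derivative h' r) (at r)" using h_deriv[OF r] .
  show "(h' has_real_derivative cubic c (h r) + 6 * h r / r\<^sup>2 - 2 / r * h' r) (at r)"
    using h_deriv2[OF r] h0 assms(2)[OF r] by (simp add: clamp01_id)
qed (use c in auto)

end

text \<open>Both shooting sets are unions over r of conditions at a single r, so pointwise
  continuity in A makes them open. Connectedness of [1 / 500, 2] yields an A in neither.\<close>

lemma profile_exists:
  assumes c: "0 \<le> c" "c \<le> 1 / 4"
  shows "\<exists>h h'. hedgehog_profile c h h' \<and> continuous_on {0..} h \<and> h 0 = 0"
proof -
  obtain w :: "real \<Rightarrow> real \<Rightarrow> real" where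
    w: "\<And>A. continuous_on {0..} (w A)"
      "\<And>A r. 0 \<le> r \<Longrightarrow> w A r = A + radial_int (\<lambda>s. source c s (w A s)) r"
    and wA: "\<And>r. 0 \<le> r \<Longrightarrow> continuous_on UNIV (\<lambda>A. w A r)"
    using fixed_points[OF c] by blast
  have shot: "truncated_solution c A (w A)" if "0 < A" for A
    using c that w by unfold_locales
  define U where "U = (\<Union>r\<in>{0<..}. {A. 1 < r\<^sup>2 * w A r})"
  define V where "V = (\<Union>r\<in>{0<..}. {A. w A r < 0})"
  have "open U" unfolding U_def
    by (intro open_UN ballI open_Collect_less continuous_intros wA) auto
  moreover have "open V" unfolding V_def
    by (intro open_UN ballI open_Collect_less continuous_intros wA) auto
  moreover have "connected {1 / 500..2 :: real}" by simp
  moreover have "2 \<in> U"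
  proof -
    interpret truncated_solution c 2 "w 2" by (rule shot) simp
    show ?thesis using w_1_ge by (auto simp: U_def intro!: bexI[of _ 1])
  qed
  then have "U \<inter> {1 / 500..2} \<noteq> {}" by auto
  moreover have "1 / 500 \<in> V"
  proof -
    interpret truncated_solution c "1 / 500" "w (1 / 500)" by (rule shot) simp
    show ?thesis using negative_somewhere by (auto simp: V_def)
  qed
  then have "V \<inter> {1 / 500..2} \<noteq> {}" by auto
  \<comment> \<open>An overshoot followed by a negative value contradicts
    \<open>overshoot_persists\<close>; the opposite order contradicts monotonicity of w.\<close>
  moreover have "U \<inter> V \<inter> {1 / 500..2} = {}"
  proof (rule ccontr)
    assume "U \<inter> V \<inter> {1 / 500..2} \<noteq> {}"
    then obtain A r s where A: "1 / 500 \<le> A" and r: "0 < r" "1 < r\<^sup>2 * w A r"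
      and s: "0 < s" "w A s < 0" by (auto simp: U_def V_def)
    interpret truncated_solution c A "w A" by (rule shot) (use A in simp)
    have hs: "h s \<le> 0" unfolding h_def using s by (intro mult_nonneg_nonpos) auto
    show False
    proof (cases "r \<le> s")
      case True
      then show False using overshoot_persists[of r s] r hs by (simp add: h_def)
    next
      case False
      then have "w A r < 0" using w_antimono[of s r] s by simp
      then have "r\<^sup>2 * w A r \<le> 0" by (intro mult_nonneg_nonpos) auto
      then show False using r by simp
    qed
  qed
  ultimately have "\<not> {1 / 500..2} \<subseteq> U \<union> V"
    unfolding connected_def by blast
  then obtain A where "A \<in> {1 / 500..2}" and nUV: "A \<notin> U" "A \<notin> V" by blast
  then have "0 < A" by simp
  interpret truncated_solution c A "w A" by (rule shot) (rule \<open>0 < A\<close>)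
  have "hedgehog_profile c h h'"
  proof (rule profile)
    fix r :: real assume "0 < r"
    then have "\<not> w A r < 0" "\<not> 1 < r\<^sup>2 * w A r" using nUV unfolding U_def V_def by auto
    then show "0 \<le> w A r" "h r \<le> 1" by (simp_all add: h_def)
  qed
  moreover have "h 0 = 0" by (simp add: h_def)
  ultimately show ?thesis using h_cont by (intro exI[of _ h] exI[of _ h'] conjI)
qed

section \<open>Passage between the boundary value problem and profiles\<close>

lemma solution_le_1:
  fixes h h' h'' :: "real \<Rightarrow> real"
  assumes c: "0 \<le> c"
    and d1: "\<And>r. 0 < r \<Longrightarrow> (h has_real_derivative h' r) (at r)"
    and d2: "\<And>r. 0 < r \<Longrightarrow> (h' has_real_derivative h'' r) (at r)"
    and ode: "\<And>r. 0 < r \<Longrightarrow> h'' r + 2 / r * h' r - 6 * h r / r\<^sup>2 = cubic c (h r)"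
    and cont: "continuous_on {0..} h" and h0: "h 0 = 0" and lim: "(h \<longlongrightarrow> 1) at_top"
    and s: "0 < s"
  shows "h s \<le> 1"
proof (rule ccontr)
  assume "\<not> h s \<le> 1"
  \<comment> \<open>A level strictly above 1 is needed: the limit 1 then brings h below m at some
    finite X, and the maximum principle applies to h - m on [0,X].\<close>
  define m where "m = (1 + h s) / 2"
  have m: "1 < m" "m < h s" using \<open>\<not> h s \<le> 1\<close> by (auto simp: m_def)
  have "\<forall>\<^sub>F r in at_top. h r < m" using order_tendstoD(2)[OF lim m(1)] .
  then obtain X where X: "s \<le> X" "h X < m"
    by (metis eventually_at_top_linorder linorder_le_cases order_refl)
  have "h s - m \<le> 0"
  proof (rule no_interior_positive_max[where a = 0 and b = X and D = "\<lambda>r. h r - m"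
      and ?D1.0 = h' and ?D2.0 = h''])
    show "continuous_on {0..X} (\<lambda>r. h r - m)"
      by (intro continuous_intros continuous_on_subset[OF cont]) auto
    show "((\<lambda>r. h r - m) has_real_derivative h' y) (at y)" if "0 < y" for y
      using DERIV_diff[OF d1[OF that] DERIV_const[of m]] by simp
    fix y assume y: "0 < y" "0 < h y - m" "h' y = 0"
    have h1: "1 < h y" using y m by simp
    then have "0 \<le> cubic c (h y)" unfolding cubic_factor
      using c by (intro mult_nonneg_nonneg) auto
    moreover have "0 < 6 * h y / y\<^sup>2" using h1 y by simp
    ultimately show "0 < h'' y" using ode[OF y(1)] y(3) by simp
  qed (use s X m h0 d2 in auto)
  with m show False by simp
qed

lemma profile_of_solution:
  assumes sol: "hedgehog_solution t g" and nn: "\<forall>r\<ge>0. 0 \<le> g r"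
    and c: "0 \<le> 3 * h_plus t / t" "3 * h_plus t / t \<le> 1 / 4"
  shows "\<exists>g'. hedgehog_profile (3 * h_plus t / t) g g'"
proof -
  define c where "c = 3 * h_plus t / t"
  obtain g' g'' where ode: "\<And>r. 0 < r \<Longrightarrow> (g has_real_derivative g' r) (at r)"
      "\<And>r. 0 < r \<Longrightarrow> (g' has_real_derivative g'' r) (at r)"
      "\<And>r. 0 < r \<Longrightarrow> g'' r + 2 / r * g' r - 6 * g r / r\<^sup>2 = cubic c (g r)"
    using sol unfolding hedgehog_solution_def cubic_def c_def by blast
  have g: "continuous_on {0..} g" "g 0 = 0" "(g \<longlongrightarrow> 1) at_top"
    using sol by (auto simp: hedgehog_solution_def)
  have "hedgehog_profile c g g'"
  proof
    show "0 \<le> c" "c \<le> 1 / 4" using c by (auto simp: c_def)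
    show "(g \<longlongrightarrow> 0) (at_right 0)"
      using g(1,2) unfolding continuous_on
      by (metis atLeast_iff at_within_Ici_at_right order_refl)
    have "\<forall>\<^sub>F r in at_top. 0 < g r \<and> 0 < r"
      using order_tendstoD(1)[OF g(3), of 0] eventually_gt_at_top[of 0] by (simp add: eventually_conj)
    then obtain r where "0 < g r" "0 < r"
      by (auto dest: eventually_happens)
    then show "\<exists>r>0. g r \<noteq> 0" by (intro exI[of _ r]) simp
    fix r :: real assume r: "0 < r"
    show "(g has_real_derivative g' r) (at r)" by (rule ode(1)[OF r])
    have "g'' r = cubic c (g r) + 6 * g r / r\<^sup>2 - 2 / r * g' r" using ode(3)[OF r] by linarith
    then show "(g' has_real_derivative cubic c (g r) + 6 * g r / r\<^sup>2 - 2 / r * g' r) (at r)"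
      using ode(2)[OF r] by simp
    show "0 \<le> g r" using nn r by simp
    show "g r \<le> 1" by (rule solution_le_1[OF _ ode g r]) (use c in \<open>simp_all add: c_def\<close>)
  qed
  then show ?thesis by (auto simp: c_def)
qed

lemma solution_of_profile:
  assumes p: "hedgehog_profile (3 * h_plus t / t) h h'"
    and "continuous_on {0..} h" "h 0 = 0"
  shows "hedgehog_solution t h"
proof -
  interpret hedgehog_profile "3 * h_plus t / t" h h' by (rule p)
  let ?h'' = "\<lambda>r. cubic (3 * h_plus t / t) (h r) + 6 * h r / r\<^sup>2 - 2 / r * h' r"
  have "\<forall>r>0. (h has_real_derivative h' r) (at r) \<and> (h' has_real_derivative ?h'' r) (at r) \<and>
      ?h'' r + 2 / r * h' r - 6 * h r / r\<^sup>2
        = - h r + h r ^ 3 + 3 * h_plus t / t * (h r ^ 3 - h r ^ 2)"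
    using deriv deriv2 by (simp add: cubic_def)
  then show ?thesis
    unfolding hedgehog_solution_def using assms(2,3) tendsto_1
    by (intro conjI exI[of _ h'] exI[of _ ?h''])
qed

text \<open>h_+ grows like the square root of t. The threshold is a crude choice making sqrt (9 + 8
  t) <= t / 1000, which leads to the 1 / 500 required for uniqueness.\<close>

lemma coefficient_small:
  assumes "100000000 \<le> t"
  shows "0 \<le> 3 * h_plus t / t" "3 * h_plus t / t \<le> 1 / 500"
proof -
  have "100000000 * t \<le> t * t" using assms by (intro mult_right_mono) auto
  moreover have "(t / 1000)\<^sup>2 = t * t / 1000000" by (simp add: power2_eq_square)
  ultimately have "9 + 8 * t \<le> (t / 1000)\<^sup>2" using assms by linarith
  then have "sqrt (9 + 8 * t) \<le> t / 1000" using assms by (intro real_le_lsqrt) auto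
  then have "h_plus t \<le> t / 1500" using assms by (simp add: h_plus_def)
  then show "3 * h_plus t / t \<le> 1 / 500" using assms by (simp add: field_simps)
  have "0 \<le> h_plus t" using assms by (simp add: h_plus_def)
  then show "0 \<le> 3 * h_plus t / t" using assms by simp
qed

theorem proposition4p1:
  shows "\<exists>t\<^sub>0::real. t\<^sub>0 > 1 \<and> (\<forall>t\<ge>t\<^sub>0.
    \<exists>h::real \<Rightarrow> real. (hedgehog_solution t h \<and> (\<forall>r\<ge>0. h r \<ge> 0)) \<and>
      (\<forall>g::real \<Rightarrow> real. hedgehog_solution t g \<and> (\<forall>r\<ge>0. g r \<ge> 0) \<longrightarrow> (\<forall>r\<ge>0. g r = h r)))"
proof (intro exI[of _ "100000000"] conjI allI impI)
  fix t :: real assume t: "100000000 \<le> t"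
  define c where "c = 3 * h_plus t / t"
  have c: "0 \<le> c" "c \<le> 1 / 500" using coefficient_small[OF t] by (auto simp: c_def)
  obtain h h' where h: "hedgehog_profile c h h'" "continuous_on {0..} h" "h 0 = 0"
    using profile_exists[of c] c by auto
  have "hedgehog_solution t h"
    using h by (intro solution_of_profile) (auto simp: c_def)
  moreover have "0 \<le> h r" if "0 \<le> r" for r
    using hedgehog_profile.nonneg[OF h(1)] h(3) that by (cases "r = 0") auto
  moreover have "g r = h r"
    if g: "hedgehog_solution t g \<and> (\<forall>r\<ge>0. 0 \<le> g r)" and r: "0 \<le> r" for g r
  proof (cases "r = 0")
    case True
    then show ?thesis using g h(3) by (simp add: hedgehog_solution_def)
  next
    case False
    obtain g' where "hedgehog_profile c g g'"
      using profile_of_solution[of t g] g c by (auto simp: c_def)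
    then show ?thesis using profile_unique[OF _ h(1) c(2)] r False by simp
  qed
  ultimately show "\<exists>h. (hedgehog_solution t h \<and> (\<forall>r\<ge>0. h r \<ge> 0)) \<and>
      (\<forall>g. hedgehog_solution t g \<and> (\<forall>r\<ge>0. g r \<ge> 0) \<longrightarrow> (\<forall>r\<ge>0. g r = h r))"
    by (intro exI[of _ h]) blast
qed simp

end
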